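(* Let $(X,\tau,\mu,T)$ and $(Y,\tau,\nu,S)$ be nearly continuous dynamical systems that are nearly continuously even Kakutani equivalent, i.e. there are nearly clopen sets $A\subseteq X$ and $B\subseteq Y$ with $\mu(A)=\nu(B)>0$ and a nearly continuous conjugacy $\varphi$ between the induced maps $T_A$ and $S_B$, given by a homeomorphism $\varphi:A_0\to B_0$ with $\varphi\circ T_A=S_B\circ\varphi$ (where $A_0=A\cap X_0$, $B_0=B\cap Y_0$ for suitable carriers $X_0$ of $T$ and $Y_0$ of $S$). Then $\varphi$ extends to a nearly continuous orbit equivalence: there exist carriers $X^*\subseteq X$ of $T$ and $Y^*\subseteq Y$ of $S$ and a nearly continuous orbit equivalence $\hat\varphi:X^*\to Y^*$ between $T$ and $S$ such that $\hat\varphi(x)=\varphi(x)$ for every $x\in A_0\cap X^*$.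
   Context: A Polish probability space $(X,\tau,\mu)$ is an uncountable Polish space $(X,\tau)$ with a non-atomic Borel probability measure $\mu$ of full support. A subset of $X$ is nearly full if it is a $G_\delta$ set of full measure. A set $C\subseteq X$ is nearly clopen if there is a nearly full $X_0\subseteq X$ such that $C\cap X_0$ is clopen in the relative topology of $X_0$. A function on $X$ is nearly continuous if its restriction to some nearly full subset is continuous in the relative topology. A nearly continuous dynamical system $(X,\tau,\mu,T)$ is a Polish probability space together with a nearly full subset $X_0\subseteq X$ and a map $T:X_0\to X_0$ such that $X_0$ is $T$-invariant and $T$ is an ergodic homeomorphism of $X_0$ (relative topology) preserving $\mu$. A carrier of $T$ is a nearly full subset that is invariant under $T$. Two such systems on $X$ are identified if they agree on a common carrier. For a nearly clopen set $A$ with $\mu(A)>0$, choose a carrier $X_1$ of $T$ with $A_1=A\cap X_1$ clopen in $X_1$; the return time is $r_{A_1}(x)=\inf\{r>0:T^r(x)\in A_1\}$ and the induced map is $T_A=T_{A_1}=T^{r_{A_1}}$ on $A_1$, which carries the normalized restriction of $\mu$. Two systems $(X,\tau,\mu,T)$ and $(Y,\tau,\nu,S)$ are nearly continuously conjugate if there are carriers $X_0\subseteq X$, $Y_0\subseteq Y$ and a measure-preserving homeomorphism $\phi:X_0\to Y_0$ with $\phi\circ T=S\circ\phi$ on $X_0$; such a $\phi$ is a nearly continuous conjugacy. For induced maps $T_A$, $S_B$ this means a measure-preserving (for normalized measures) homeomorphism $\phi:A\cap X_0\to B\cap Y_0$, for carriers $X_0$, $Y_0$ such that $A\cap X_0$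 and $B\cap Y_0$ are clopen in $X_0$ and $Y_0$ respectively, intertwining the induced maps. Write $Orb_T(x)=\{T^i(x):i\in\mathbb Z\}$. The nearly continuous full group $[[T]]$ is the set of ergodic measure-preserving near homeomorphisms $T'$ of $X$ (homeomorphisms between nearly full subsets, defining nearly continuous dynamical systems on $X$) for which there is a common carrier $X_0$ of $T$ and $T'$ with $Orb_{T'}(x)=Orb_T(x)$ for all $x\in X_0$ and for which the cocycle $C_{T'}:X\to\mathbb Z$, defined by $T'(x)=T^{C_{T'}(x)}(x)$, is nearly continuous. A nearly continuous orbit equivalence between $T$ and $S$ is a nearly continuous conjugacy $\hat\varphi:X^*\to Y^*$ between some $T'\in[[T]]$ and some $S'\in[[S]]$, where $X^*$ is a carrier of $T$ and $T'$ and $Y^*$ is a carrier of $S$ and $S'$, and $\hat\varphi(Orb_T(x))=Orb_S(\hat\varphi(x))$ for all $x\in X^*$. *)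

theory Defs
  imports "HOL-Probability.Probability" "HOL-Library.Extended_Nat"
begin

text \<open>
  The Polish space \<open>X\<close> is the universe of a type of class \<^class>\<open>polish_space\<close>; only its topology is
  used, never the particular complete metric. A partially defined map is a total function
  together with an explicit set on which it is considered.
\<close>

definition non_atomic :: "'a measure \<Rightarrow> bool" where
  "non_atomic M \<longleftrightarrow>
     (\<forall>E\<in>sets M. 0 < emeasure M E \<longrightarrow>
        (\<exists>F\<in>sets M. F \<subseteq> E \<and> 0 < emeasure M F \<and> emeasure M F < emeasure M E))"

definition polish_prob_space :: "'a::polish_space measure \<Rightarrow> bool" where
  "polish_prob_space M \<longleftrightarrow>
     uncountable (UNIV :: 'a set) \<and> sets M = sets borel \<and> prob_space M \<and> non_atomic M \<and>
     (\<forall>U. open U \<and> U \<noteq> {} \<longrightarrow> 0 < emeasure M U)"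

definition nearly_full :: "'a::polish_space measure \<Rightarrow> 'a set \<Rightarrow> bool" where
  "nearly_full M X0 \<longleftrightarrow> gdelta X0 \<and> emeasure M X0 = 1"

definition clopen_in :: "'a::topological_space set \<Rightarrow> 'a set \<Rightarrow> bool" where
  "clopen_in X0 C \<longleftrightarrow> openin (top_of_set X0) C \<and> closedin (top_of_set X0) C"

definition nearly_clopen :: "'a::polish_space measure \<Rightarrow> 'a set \<Rightarrow> bool" where
  "nearly_clopen M C \<longleftrightarrow> (\<exists>X0. nearly_full M X0 \<and> clopen_in X0 (C \<inter> X0))"

definition nearly_continuous ::
  "'a::polish_space measure \<Rightarrow> ('a \<Rightarrow> 'b::topological_space) \<Rightarrow> bool" where
  "nearly_continuous M f \<longleftrightarrow> (\<exists>X0. nearly_full M X0 \<and> continuous_on X0 f)"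

definition measure_preserving :: "'a measure \<Rightarrow> 'b measure \<Rightarrow> ('a \<Rightarrow> 'b) \<Rightarrow> bool" where
  "measure_preserving M N f \<longleftrightarrow>
     f \<in> measurable M N \<and>
     (\<forall>E\<in>sets N. emeasure M (f -` E \<inter> space M) = emeasure N E)"

definition homeo_betw ::
  "'a::topological_space set \<Rightarrow> 'b::topological_space set \<Rightarrow> ('a \<Rightarrow> 'b) \<Rightarrow> bool" where
  "homeo_betw S T f \<longleftrightarrow> (\<exists>g. homeomorphism S T f g)"

text \<open>In \<open>nc_system M D T\<close> the set \<open>D\<close> is the nearly full domain on which \<open>T\<close> is defined.\<close>

definition nc_system :: "'a::polish_space measure \<Rightarrow> 'a set \<Rightarrow> ('a \<Rightarrow> 'a) \<Rightarrow> bool" where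
  "nc_system M D T \<longleftrightarrow>
     polish_prob_space M \<and> nearly_full M D \<and> homeo_betw D D T \<and>
     measure_preserving (restrict_space M D) (restrict_space M D) T \<and>
     (\<forall>E\<in>sets M. E \<subseteq> D \<and> T -` E \<inter> D = E \<longrightarrow> emeasure M E = 0 \<or> emeasure M E = 1)"

text \<open>Invariance is two-sided, so that \<open>T\<close> restricts to a homeomorphism of a carrier.\<close>

definition carrier_of ::
  "'a::polish_space measure \<Rightarrow> 'a set \<Rightarrow> ('a \<Rightarrow> 'a) \<Rightarrow> 'a set \<Rightarrow> bool" where
  "carrier_of M D T X0 \<longleftrightarrow> X0 \<subseteq> D \<and> nearly_full M X0 \<and> T ` X0 = X0"

definition int_iter :: "'a set \<Rightarrow> ('a \<Rightarrow> 'a) \<Rightarrow> int \<Rightarrow> 'a \<Rightarrow> 'a" where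
  "int_iter D T i = (if 0 \<le> i then T ^^ nat i else inv_into D T ^^ nat (- i))"

definition orb :: "'a set \<Rightarrow> ('a \<Rightarrow> 'a) \<Rightarrow> 'a \<Rightarrow> 'a set" where
  "orb D T x = range (\<lambda>i. int_iter D T i x)"

definition return_time :: "('a \<Rightarrow> 'a) \<Rightarrow> 'a set \<Rightarrow> 'a \<Rightarrow> enat" where
  "return_time T A x = Inf {enat r | r. 0 < r \<and> (T ^^ r) x \<in> A}"

text \<open>Meaningful only where the return time is finite.\<close>

definition induced_map :: "('a \<Rightarrow> 'a) \<Rightarrow> 'a set \<Rightarrow> 'a \<Rightarrow> 'a" where
  "induced_map T A x = (T ^^ the_enat (return_time T A x)) x"

definition normalized_restriction :: "'a measure \<Rightarrow> 'a set \<Rightarrow> 'a measure" where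
  "normalized_restriction M A = uniform_measure (restrict_space M A) A"

definition nc_conjugacy ::
  "'a::polish_space measure \<Rightarrow> 'a set \<Rightarrow> ('a \<Rightarrow> 'a) \<Rightarrow> 'a set \<Rightarrow>
   'b::polish_space measure \<Rightarrow> 'b set \<Rightarrow> ('b \<Rightarrow> 'b) \<Rightarrow> 'b set \<Rightarrow> ('a \<Rightarrow> 'b) \<Rightarrow> bool" where
  "nc_conjugacy M D T X0 N E S Y0 \<phi> \<longleftrightarrow>
     carrier_of M D T X0 \<and> carrier_of N E S Y0 \<and>
     homeo_betw X0 Y0 \<phi> \<and>
     measure_preserving (restrict_space M X0) (restrict_space N Y0) \<phi> \<and>
     (\<forall>x\<in>X0. \<phi> (T x) = S (\<phi> x))"

text \<open>
  A null set of points of \<open>A \<inter> X0\<close> may never return, and the induced map is undefined there. The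
  intertwining relation is imposed exactly where both of its sides are defined.
\<close>

definition nc_induced_conjugacy ::
  "'a::polish_space measure \<Rightarrow> 'a set \<Rightarrow> ('a \<Rightarrow> 'a) \<Rightarrow> 'a set \<Rightarrow> 'a set \<Rightarrow>
   'b::polish_space measure \<Rightarrow> 'b set \<Rightarrow> ('b \<Rightarrow> 'b) \<Rightarrow> 'b set \<Rightarrow> 'b set \<Rightarrow> ('a \<Rightarrow> 'b) \<Rightarrow> bool" where
  "nc_induced_conjugacy M D T A X0 N E S B Y0 \<phi> \<longleftrightarrow>
     carrier_of M D T X0 \<and> clopen_in X0 (A \<inter> X0) \<and>
     carrier_of N E S Y0 \<and> clopen_in Y0 (B \<inter> Y0) \<and>
     homeo_betw (A \<inter> X0) (B \<inter> Y0) \<phi> \<and>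
     measure_preserving (normalized_restriction M (A \<inter> X0))
       (normalized_restriction N (B \<inter> Y0)) \<phi> \<and>
     (\<forall>x\<in>A \<inter> X0.
        return_time T (A \<inter> X0) x < \<infinity> \<and> return_time S (B \<inter> Y0) (\<phi> x) < \<infinity> \<longrightarrow>
        \<phi> (induced_map T (A \<inter> X0) x) = induced_map S (B \<inter> Y0) (\<phi> x))"

text \<open>
  The pair \<open>(D', T')\<close> belongs to the nearly continuous full group of \<open>(D, T)\<close>. The cocycle \<open>C\<close> is
  determined by \<open>T'\<close> off the null set of \<open>T\<close>-periodic points.
\<close>

definition full_group ::
  "'a::polish_space measure \<Rightarrow> 'a set \<Rightarrow> ('a \<Rightarrow> 'a) \<Rightarrow> ('a set \<times> ('a \<Rightarrow> 'a)) set" where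
  "full_group M D T =
     {(D', T'). nc_system M D' T' \<and>
        (\<exists>X0. carrier_of M D T X0 \<and> carrier_of M D' T' X0 \<and>
           (\<forall>x\<in>X0. orb D' T' x = orb D T x) \<and>
           (\<exists>C :: 'a \<Rightarrow> int. nearly_continuous M C \<and> (\<forall>x\<in>X0. T' x = int_iter D T (C x) x)))}"

definition nc_orbit_equivalence ::
  "'a::polish_space measure \<Rightarrow> 'a set \<Rightarrow> ('a \<Rightarrow> 'a) \<Rightarrow> 'a set \<Rightarrow>
   'b::polish_space measure \<Rightarrow> 'b set \<Rightarrow> ('b \<Rightarrow> 'b) \<Rightarrow> 'b set \<Rightarrow> ('a \<Rightarrow> 'b) \<Rightarrow> bool" where
  "nc_orbit_equivalence M D T X0 N E S Y0 \<phi> \<longleftrightarrow>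
     carrier_of M D T X0 \<and> carrier_of N E S Y0 \<and>
     (\<exists>D' T' E' S'. (D', T') \<in> full_group M D T \<and> (E', S') \<in> full_group N E S \<and>
        nc_conjugacy M D' T' X0 N E' S' Y0 \<phi>) \<and>
     (\<forall>x\<in>X0. \<phi> ` orb D T x = orb E S (\<phi> x))"

end

theory Submission
  imports Defs
begin

text \<open>
  The conjugacy \<open>\<phi>\<close> between the induced maps pairs up almost all \<open>T\<close>-orbits with almost all
  \<open>S\<close>-orbits: two visits to \<open>A\<close> lie on the same \<open>T\<close>-orbit if and only if their images under \<open>\<phi>\<close>
  lie on the same \<open>S\<close>-orbit (lemmas \<open>cocycle\<close> and \<open>orbit_reflect\<close>). It remains to extend \<open>\<phi>\<close> to
  a measure-preserving near homeomorphism that sends every orbit onto its partner.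

  Points \<open>x\<close> and \<open>y\<close> lie on paired orbits when \<open>y = S\<^sup>j (\<phi> (T\<^sup>i x))\<close> for some \<open>i \<ge> 0\<close> with
  \<open>T\<^sup>i x \<in> A\<close> and some integer \<open>j\<close>. So the pairing is exhausted by countably many partial maps, each
  a measure-preserving homeomorphism between relatively clopen sets. These maps are processed one
  after the other, starting with \<open>i = j = 0\<close>, that is, with \<open>\<phi>\<close> itself: the map whose turn it is
  matches every point that is still unmatched and has an unmatched image. Every stage deals with a
  relatively clopen set, so the union \<open>h\<close> of all stages is a homeomorphism between relatively open
  sets, and it extends \<open>\<phi>\<close> and preserves measure.

  Nothing of positive measure is left over. The two sets of unmatched points have the same measure,
  since \<open>X\<close> and \<open>Y\<close> both have measure one, and an unmatched point of \<open>X\<close> is never paired with an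
  unmatched point of \<open>Y\<close> (\<open>unmatched_unrelated\<close>). If both sets had positive measure, ergodicity
  would make almost every orbit on either side run into them, and then some two paired orbits would
  both do so (\<open>unmatched_null\<close>). The unmatched points are therefore null, and relatively closed.
  Together with all orbits related to them they can be removed, in such a way that carriers remain
  which still correspond under \<open>\<phi>\<close> (\<open>saturate\<close>). The same device serves before the matching to
  discard the points whose orbits visit \<open>A\<close> or \<open>B\<close> only finitely often.

  The required elements of the full groups are \<open>T\<close> itself and \<open>S' = h T h_inv\<close>. The cocycle of \<open>S'\<close>
  is continuous because it is computed from the index of the matching stage, which is constant on
  relatively clopen sets, and from first return times to \<open>B\<close>, which are locally constant
  (\<open>h_T\<close>, \<open>locally_constant_on_conj_cocycle\<close>).
\<close>

section \<open>Locally constant functions and clopen sets\<close>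

text \<open>
  No topology on the codomain enters, so that predicates, indices and integer-valued cocycles can be
  treated alike.
\<close>

definition locally_constant_on :: "'a::topological_space set \<Rightarrow> ('a \<Rightarrow> 'b) \<Rightarrow> bool" where
  "locally_constant_on X f \<longleftrightarrow> (\<forall>x\<in>X. \<forall>\<^sub>F y in at x within X. f y = f x)"

lemma locally_constant_on_open:
  "locally_constant_on X f \<longleftrightarrow>
    (\<forall>x\<in>X. \<exists>U. open U \<and> x \<in> U \<and> (\<forall>y\<in>U \<inter> X. f y = f x))"
  unfolding locally_constant_on_def eventually_at_topological by (intro ball_cong) auto

lemma locally_constant_on_subset:
  "locally_constant_on X f \<Longrightarrow> Y \<subseteq> X \<Longrightarrow> locally_constant_on Y f"
  unfolding locally_constant_on_def eventually_at_topological by (meson subsetD)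

lemma locally_constant_on_imp_continuous_on:
  "locally_constant_on X f \<Longrightarrow> continuous_on X f"
  unfolding locally_constant_on_def continuous_on_def by (auto intro: tendsto_eventually)

lemma locally_constant_on_compose:
  assumes f: "locally_constant_on Y f" and g: "continuous_on X g" "g ` X \<subseteq> Y"
  shows "locally_constant_on X (\<lambda>x. f (g x))"
  unfolding locally_constant_on_open
proof
  fix x assume x: "x \<in> X"
  then obtain V where V: "open V" "g x \<in> V" "\<forall>y\<in>V \<inter> Y. f y = f (g x)"
    using f g(2) unfolding locally_constant_on_open by blast
  then obtain U where "open U" "x \<in> U" "\<forall>y\<in>X. y \<in> U \<longrightarrow> g y \<in> V"
    using g(1) x unfolding continuous_on_topological by blast
  then show "\<exists>U. open U \<and> x \<in> U \<and> (\<forall>y\<in>U \<inter> X. f (g y) = f (g x))"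
    using V(3) g(2) by blast
qed

lemma locally_constant_on_map2:
  assumes "locally_constant_on X f" "locally_constant_on X g"
  shows "locally_constant_on X (\<lambda>x. h (f x) (g x))"
  unfolding locally_constant_on_def
proof
  fix x assume "x \<in> X"
  then have "\<forall>\<^sub>F y in at x within X. f y = f x" "\<forall>\<^sub>F y in at x within X. g y = g x"
    using assms unfolding locally_constant_on_def by auto
  then show "\<forall>\<^sub>F y in at x within X. h (f y) (g y) = h (f x) (g x)"
    by eventually_elim simp
qed

text \<open>
  Near a given point the index does not change, so only one member of the family is involved there.
\<close>

lemma locally_constant_on_select:
  assumes "locally_constant_on X i" "\<And>n. locally_constant_on X (g n)"
  shows "locally_constant_on X (\<lambda>x. g (i x) x)"
  unfolding locally_constant_on_def
proof
  fix x assume "x \<in> X"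
  then have "\<forall>\<^sub>F y in at x within X. i y = i x"
    "\<forall>\<^sub>F y in at x within X. g (i x) y = g (i x) x"
    using assms unfolding locally_constant_on_def by auto
  then show "\<forall>\<^sub>F y in at x within X. g (i y) y = g (i x) x"
    by eventually_elim simp
qed

lemma locally_constant_on_All_finite:
  assumes "finite I" "\<And>k. k \<in> I \<Longrightarrow> locally_constant_on X (Q k)"
  shows "locally_constant_on X (\<lambda>x. \<forall>k\<in>I. Q k x)"
  unfolding locally_constant_on_def
proof
  fix x assume "x \<in> X"
  then have "\<forall>\<^sub>F y in at x within X. \<forall>k\<in>I. Q k y = Q k x"
    using assms unfolding locally_constant_on_def by (simp add: eventually_ball_finite)
  then show "\<forall>\<^sub>F y in at x within X. (\<forall>k\<in>I. Q k y) = (\<forall>k\<in>I. Q k x)"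
    by eventually_elim simp
qed

lemma locally_constant_on_sum:
  fixes f :: "'i \<Rightarrow> 'a::topological_space \<Rightarrow> 'b::comm_monoid_add"
  assumes "finite I" "\<And>k. k \<in> I \<Longrightarrow> locally_constant_on X (f k)"
  shows "locally_constant_on X (\<lambda>x. \<Sum>k\<in>I. f k x)"
  unfolding locally_constant_on_def
proof
  fix x assume "x \<in> X"
  then have "\<forall>\<^sub>F y in at x within X. \<forall>k\<in>I. f k y = f k x"
    using assms unfolding locally_constant_on_def by (simp add: eventually_ball_finite)
  then show "\<forall>\<^sub>F y in at x within X. (\<Sum>k\<in>I. f k y) = (\<Sum>k\<in>I. f k x)"
    by eventually_elim simp
qed

text \<open>
  Local constancy is stable under continuous substitution and under finite Boolean combinations, so
  this is the way in which sets given by conditions on iterates are recognized as clopen.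
\<close>

lemma clopen_in_iff_locally_constant_on:
  "clopen_in X C \<longleftrightarrow> C \<subseteq> X \<and> locally_constant_on X (\<lambda>x. x \<in> C)"
proof
  assume C: "clopen_in X C"
  then obtain U V where U: "open U" "C = X \<inter> U" and V: "open V" "X - C = X \<inter> V"
    unfolding clopen_in_def closedin_def openin_open by auto
  show "C \<subseteq> X \<and> locally_constant_on X (\<lambda>x. x \<in> C)"
    unfolding locally_constant_on_open
  proof (intro conjI ballI)
    show "C \<subseteq> X" using U by auto
    fix x assume "x \<in> X"
    show "\<exists>W. open W \<and> x \<in> W \<and> (\<forall>y\<in>W \<inter> X. (y \<in> C) = (x \<in> C))"
    proof (cases "x \<in> C")
      case True
      then show ?thesis using U by (intro exI[of _ U]) auto
    next
      case False
      then show ?thesis using V \<open>x \<in> X\<close> by (intro exI[of _ V]) auto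
    qed
  qed
next
  assume C: "C \<subseteq> X \<and> locally_constant_on X (\<lambda>x. x \<in> C)"
  have op: "openin (top_of_set X) {x\<in>X. (x \<in> C) = b}" for b
  proof (subst openin_subopen, intro ballI)
    fix x assume x: "x \<in> {x\<in>X. (x \<in> C) = b}"
    then obtain U where "open U" "x \<in> U" "\<forall>y\<in>U \<inter> X. (y \<in> C) = (x \<in> C)"
      using C unfolding locally_constant_on_open by blast
    then show "\<exists>T. openin (top_of_set X) T \<and> x \<in> T \<and> T \<subseteq> {x\<in>X. (x \<in> C) = b}"
      using x by (intro exI[of _ "X \<inter> U"]) auto
  qed
  have "{x\<in>X. (x \<in> C) = True} = C" "{x\<in>X. (x \<in> C) = False} = X - C"
    using C by auto
  with op[of True] op[of False] C show "clopen_in X C"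
    unfolding clopen_in_def closedin_def by simp
qed

lemma clopen_in_Collect_iff:
  "clopen_in X {x\<in>X. P x} \<longleftrightarrow> locally_constant_on X P"
  unfolding clopen_in_iff_locally_constant_on locally_constant_on_open by auto

lemma clopen_in_trans: "clopen_in U C \<Longrightarrow> clopen_in X U \<Longrightarrow> clopen_in X C"
  unfolding clopen_in_def using openin_trans closedin_trans by blast

lemma clopen_in_image:
  "homeomorphism U V f g \<Longrightarrow> clopen_in U C \<Longrightarrow> clopen_in V (f ` C)"
  unfolding clopen_in_def
  by (blast intro: homeomorphism_imp_open_map homeomorphism_imp_closed_map)

lemma clopen_in_subspace:
  assumes "clopen_in X C" "Y \<subseteq> X"
  shows "clopen_in Y (C \<inter> Y)"
proof -
  have "locally_constant_on Y (\<lambda>x. x \<in> C)"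
    using assms locally_constant_on_subset unfolding clopen_in_iff_locally_constant_on by blast
  then have "clopen_in Y {x\<in>Y. x \<in> C}" by (simp add: clopen_in_Collect_iff)
  moreover have "{x\<in>Y. x \<in> C} = C \<inter> Y" by blast
  ultimately show ?thesis by simp
qed

lemma locally_constant_on_if:
  assumes "clopen_in X C" "locally_constant_on C f"
  shows "locally_constant_on X (\<lambda>x. if x \<in> C then f x else c)"
  unfolding locally_constant_on_open
proof
  fix x assume x: "x \<in> X"
  obtain U where U: "open U" "x \<in> U" "\<forall>y\<in>U \<inter> X. (y \<in> C) = (x \<in> C)"
    using assms(1) x unfolding clopen_in_iff_locally_constant_on locally_constant_on_open by blast
  have CX: "C \<subseteq> X" using assms(1) by (simp add: clopen_in_iff_locally_constant_on)
  show "\<exists>U. open U \<and> x \<in> U \<and>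
      (\<forall>y\<in>U \<inter> X. (if y \<in> C then f y else c) = (if x \<in> C then f x else c))"
  proof (cases "x \<in> C")
    case True
    then obtain V where V: "open V" "x \<in> V" "\<forall>y\<in>V \<inter> C. f y = f x"
      using assms(2) unfolding locally_constant_on_open by blast
    show ?thesis
    proof (intro exI[of _ "U \<inter> V"] conjI ballI)
      fix y assume y: "y \<in> U \<inter> V \<inter> X"
      then have "y \<in> C" using U(3) True by blast
      then show "(if y \<in> C then f y else c) = (if x \<in> C then f x else c)"
        using y V(3) True by simp
    qed (use U V in auto)
  next
    case False
    then have "\<forall>y\<in>U \<inter> X. y \<notin> C" using U(3) by blast
    with U(1,2) False show ?thesis by (intro exI[of _ U]) simp
  qed
qed

section \<open>Gluing homeomorphisms of disjoint open pieces\<close>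

definition glue :: "(nat \<Rightarrow> 'a set) \<Rightarrow> (nat \<Rightarrow> 'a \<Rightarrow> 'b) \<Rightarrow> 'a \<Rightarrow> 'b" where
  "glue P f x = f (THE n. x \<in> P n) x"

lemma the_piece: "disjoint_family P \<Longrightarrow> x \<in> P n \<Longrightarrow> (THE n. x \<in> P n) = n"
  by (rule the_equality) (auto dest: disjoint_family_onD)

lemma glue_eq: "disjoint_family P \<Longrightarrow> x \<in> P n \<Longrightarrow> glue P f x = f n x"
  by (simp add: glue_def the_piece)

lemma locally_constant_on_the_piece:
  assumes "disjoint_family P" "\<And>n. openin (top_of_set X) (P n)"
  shows "locally_constant_on (\<Union>n. P n) (\<lambda>x. THE n. x \<in> P n)"
  unfolding locally_constant_on_open
proof
  fix x assume "x \<in> (\<Union>n. P n)"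
  then obtain n where n: "x \<in> P n" by blast
  obtain U where U: "open U" "P n = X \<inter> U" using assms(2)[of n] unfolding openin_open by blast
  have "\<Union>(range P) \<subseteq> X" using openin_imp_subset[OF assms(2)] by (rule UN_least)
  show "\<exists>U. open U \<and> x \<in> U \<and>
      (\<forall>y\<in>U \<inter> \<Union>(range P). (THE n. y \<in> P n) = (THE n. x \<in> P n))"
  proof (intro exI[of _ U] conjI ballI)
    fix y assume "y \<in> U \<inter> \<Union>(range P)"
    then have "y \<in> P n" using U(2) \<open>\<Union>(range P) \<subseteq> X\<close> by blast
    then show "(THE n. y \<in> P n) = (THE n. x \<in> P n)"
      using the_piece[OF assms(1)] n by metis
  qed (use U n in auto)
qed

lemma continuous_on_glue:
  assumes "disjoint_family P" "\<And>n. openin (top_of_set X) (P n)"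
    "\<And>n. continuous_on (P n) (f n)"
  shows "continuous_on (\<Union>n. P n) (glue P f)"
  unfolding continuous_on_topological
proof (intro ballI allI impI)
  fix x B assume "x \<in> (\<Union>n. P n)" "open B" "glue P f x \<in> B"
  then obtain n where n: "x \<in> P n" by blast
  then have fn: "f n x \<in> B" using \<open>glue P f x \<in> B\<close> by (simp add: glue_eq[OF assms(1)])
  obtain U where U: "open U" "P n = X \<inter> U" using assms(2)[of n] unfolding openin_open by blast
  obtain V where V: "open V" "x \<in> V" "\<forall>y\<in>P n. y \<in> V \<longrightarrow> f n y \<in> B"
    using assms(3)[of n] n fn \<open>open B\<close> unfolding continuous_on_topological by blast
  have sub: "\<Union>(range P) \<subseteq> X" using openin_imp_subset[OF assms(2)] by (rule UN_least)
  show "\<exists>A. open A \<and> x \<in> A \<and> (\<forall>y\<in>\<Union>n. P n. y \<in> A \<longrightarrow> glue P f y \<in> B)"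
  proof (intro exI[of _ "U \<inter> V"] conjI ballI impI)
    fix y assume "y \<in> (\<Union>n. P n)" "y \<in> U \<inter> V"
    then have "y \<in> P n" "y \<in> V" using U(2) sub by blast+
    then show "glue P f y \<in> B" using V(3) glue_eq[OF assms(1), of y n f] by simp
  qed (use U V n in auto)
qed

text \<open>
  Both the pieces and their images are open and pairwise disjoint, so the glued map and the glued
  inverse are each continuous as soon as they are continuous piece by piece.
\<close>

lemma homeomorphism_glue:
  assumes P: "disjoint_family P" "\<And>n. openin (top_of_set X) (P n)"
    and Q: "disjoint_family Q" "\<And>n. openin (top_of_set Y) (Q n)"
    and h: "\<And>n. homeomorphism (P n) (Q n) (f n) (g n)"
  shows "homeomorphism (\<Union>n. P n) (\<Union>n. Q n) (glue P f) (glue Q g)"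
proof
  have h': "f n x \<in> Q n" "g n (f n x) = x" if "x \<in> P n" for n x
    using h[of n] that unfolding homeomorphism_def by auto
  have h'': "g n x \<in> P n" "f n (g n x) = x" if "x \<in> Q n" for n x
    using h[of n] that unfolding homeomorphism_def by auto
  show "continuous_on (\<Union>n. P n) (glue P f)"
    by (rule continuous_on_glue[OF P]) (use h in \<open>auto simp: homeomorphism_def\<close>)
  show "continuous_on (\<Union>n. Q n) (glue Q g)"
    by (rule continuous_on_glue[OF Q]) (use h in \<open>auto simp: homeomorphism_def\<close>)
  note gP = glue_eq[OF P(1)] and gQ = glue_eq[OF Q(1)]
  show "glue P f ` (\<Union>n. P n) \<subseteq> (\<Union>n. Q n)"
    using h'(1) by (auto simp: gP intro: UN_I)
  show "glue Q g ` (\<Union>n. Q n) \<subseteq> (\<Union>n. P n)"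
    using h''(1) by (auto simp: gQ intro: UN_I)
  show "glue Q g (glue P f x) = x" if x: "x \<in> (\<Union>n. P n)" for x
  proof -
    obtain n where "x \<in> P n" using x by blast
    then show ?thesis using gP[of x n f] gQ[of "f n x" n g] h'[of x n] by simp
  qed
  show "glue P f (glue Q g x) = x" if x: "x \<in> (\<Union>n. Q n)" for x
  proof -
    obtain n where "x \<in> Q n" using x by blast
    then show ?thesis using gQ[of x n g] gP[of "g n x" n f] h''[of x n] by simp
  qed
qed

section \<open>Greedy matching along a sequence of partial homeomorphisms\<close>

fun greedy_piece :: "(nat \<Rightarrow> 'a set) \<Rightarrow> (nat \<Rightarrow> 'a \<Rightarrow> 'b) \<Rightarrow> nat \<Rightarrow> 'a set" where
  "greedy_piece U f n =
    {x\<in>U n. \<forall>k\<in>{..<n}. x \<notin> greedy_piece U f k \<and> f n x \<notin> f k ` greedy_piece U f k}"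

declare greedy_piece.simps [simp del]

lemma greedy_piece_subset: "greedy_piece U f n \<subseteq> U n"
  by (subst greedy_piece.simps) auto

lemma greedy_piece_0: "greedy_piece U f 0 = U 0"
  by (subst greedy_piece.simps) auto

lemma disjoint_family_greedy_piece: "disjoint_family (greedy_piece U f)"
proof -
  have "greedy_piece U f k \<inter> greedy_piece U f n = {}" if "k < n" for k n
    using that by (subst (2) greedy_piece.simps) auto
  then show ?thesis
    unfolding disjoint_family_on_def by (metis Int_commute linorder_neq_iff)
qed

lemma disjoint_family_greedy_image: "disjoint_family (\<lambda>n. f n ` greedy_piece U f n)"
proof -
  have "f k ` greedy_piece U f k \<inter> f n ` greedy_piece U f n = {}" if "k < n" for k n
  proof -
    have "f n x \<notin> f k ` greedy_piece U f k" if "x \<in> greedy_piece U f n" for x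
      using that \<open>k < n\<close> by (subst (asm) greedy_piece.simps) simp
    then show ?thesis unfolding disjoint_iff by (metis imageE)
  qed
  then show ?thesis
    unfolding disjoint_family_on_def by (metis Int_commute linorder_neq_iff)
qed

text \<open>
  A point of \<open>U n\<close> that is never matched was still free at stage \<open>n\<close>, so only an image that was
  already taken can have prevented its being matched there. In particular no map of the sequence
  sends an unmatched point to an unmatched point.
\<close>

lemma greedy_piece_maximal:
  assumes "x \<in> U n" "x \<notin> (\<Union>k. greedy_piece U f k)"
  shows "f n x \<in> (\<Union>k. f k ` greedy_piece U f k)"
proof -
  have "x \<notin> greedy_piece U f n" using assms by blast
  then obtain k where "k < n" "x \<in> greedy_piece U f k \<or> f n x \<in> f k ` greedy_piece U f k"
    using assms(1) by (subst (asm) greedy_piece.simps) auto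
  then show ?thesis using assms(2) by blast
qed

text \<open>
  At stage \<open>n\<close> only the finitely many earlier pieces and the preimages of their images under the
  continuous map \<open>f n\<close> are cut out of \<open>U n\<close>, and by induction all of these are clopen.
\<close>

lemma clopen_in_greedy_piece:
  assumes U: "\<And>n. clopen_in X (U n)" and V: "\<And>n. clopen_in Y (V n)"
    and h: "\<And>n. homeomorphism (U n) (V n) (f n) (g n)"
  shows "clopen_in X (greedy_piece U f n)" "clopen_in Y (f n ` greedy_piece U f n)"
proof (induction n rule: less_induct)
  case (less n)
  have sub: "U n \<subseteq> X" "V n \<subseteq> Y" "f n ` U n = V n" "continuous_on (U n) (f n)"
    using U[of n] V[of n] h[of n]
    by (auto simp: clopen_in_iff_locally_constant_on homeomorphism_def)
  have "locally_constant_on (U n) (\<lambda>x. \<forall>k\<in>{..<n}. x \<notin> greedy_piece U f k \<and>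
      f n x \<notin> f k ` greedy_piece U f k)"
  proof (rule locally_constant_on_All_finite)
    fix k assume k: "k \<in> {..<n}"
    have "locally_constant_on X (\<lambda>x. x \<in> greedy_piece U f k)"
      using less(1)[of k] k by (simp add: clopen_in_iff_locally_constant_on)
    from locally_constant_on_map2[OF this this, of "\<lambda>a b. \<not> a"]
    have 1: "locally_constant_on (U n) (\<lambda>x. x \<notin> greedy_piece U f k)"
      using locally_constant_on_subset sub(1) by blast
    have *: "locally_constant_on Y (\<lambda>y. y \<in> f k ` greedy_piece U f k)"
      using less(2)[of k] k by (simp add: clopen_in_iff_locally_constant_on)
    have "locally_constant_on Y (\<lambda>y. y \<notin> f k ` greedy_piece U f k)"
      using locally_constant_on_map2[OF * *, of "\<lambda>a b. \<not> a"] .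
    then have 2: "locally_constant_on (U n) (\<lambda>x. f n x \<notin> f k ` greedy_piece U f k)"
      by (rule locally_constant_on_compose) (use sub in auto)
    show "locally_constant_on (U n)
        (\<lambda>x. x \<notin> greedy_piece U f k \<and> f n x \<notin> f k ` greedy_piece U f k)"
      using locally_constant_on_map2[OF 1 2, of "(\<and>)"] .
  qed simp
  then have c: "clopen_in (U n) (greedy_piece U f n)"
    by (subst greedy_piece.simps) (simp add: clopen_in_Collect_iff)
  show "clopen_in X (greedy_piece U f n)" using clopen_in_trans[OF c U] .
  show "clopen_in Y (f n ` greedy_piece U f n)"
    using clopen_in_trans[OF clopen_in_image[OF h c] V] .
qed

section \<open>Measure-preserving homeomorphisms\<close>

lemma clopen_in_borel: "clopen_in X C \<Longrightarrow> X \<in> sets borel \<Longrightarrow> C \<in> sets borel"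
  unfolding clopen_in_def openin_open by auto

lemma homeomorphism_image_borel:
  assumes h: "homeomorphism X Y f g" and "X \<in> sets borel" "Y \<in> sets borel"
    and E: "E \<in> sets borel" "E \<subseteq> X"
  shows "f ` E \<in> sets borel"
proof -
  have "g \<in> borel_measurable (restrict_space borel Y)"
    using h by (intro borel_measurable_continuous_on_restrict) (simp add: homeomorphism_def)
  then have "g -` E \<inter> space (restrict_space borel Y) \<in> sets (restrict_space borel Y)"
    using E(1) by (rule measurable_sets)
  moreover have "g -` E \<inter> space (restrict_space borel Y) = f ` E"
    using h E(2) unfolding space_restrict_space homeomorphism_def by auto
  ultimately show ?thesis
    using assms(3) by (auto simp: sets_restrict_space_iff)
qed

text \<open>
  The inverse is an explicit argument and preservation of measure refers to forward images of Borel
  sets, which are Borel again. This makes the notion symmetric in the two maps and lets it be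
  composed, restricted and glued without mentioning measurability.
\<close>

definition mp_homeo ::
  "'a::topological_space measure \<Rightarrow> 'a set \<Rightarrow> 'b::topological_space measure \<Rightarrow> 'b set \<Rightarrow>
   ('a \<Rightarrow> 'b) \<Rightarrow> ('b \<Rightarrow> 'a) \<Rightarrow> bool" where
  "mp_homeo M X N Y f g \<longleftrightarrow>
     homeomorphism X Y f g \<and> X \<in> sets borel \<and> Y \<in> sets borel \<and>
     (\<forall>E\<in>sets borel. E \<subseteq> X \<longrightarrow> emeasure N (f ` E) = emeasure M E)"

lemma mp_homeoD:
  assumes "mp_homeo M X N Y f g"
  shows "homeomorphism X Y f g" "X \<in> sets borel" "Y \<in> sets borel"
    "continuous_on X f" "continuous_on Y g" "f ` X = Y" "g ` Y = X"
    "\<And>x. x \<in> X \<Longrightarrow> f x \<in> Y" "\<And>y. y \<in> Y \<Longrightarrow> g y \<in> X"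
    "\<And>x. x \<in> X \<Longrightarrow> g (f x) = x" "\<And>y. y \<in> Y \<Longrightarrow> f (g y) = y"
  using assms unfolding mp_homeo_def homeomorphism_def by auto

lemma mp_homeo_emeasure_image:
  "mp_homeo M X N Y f g \<Longrightarrow> E \<in> sets borel \<Longrightarrow> E \<subseteq> X \<Longrightarrow>
    emeasure N (f ` E) = emeasure M E"
  by (simp add: mp_homeo_def)

lemma mp_homeo_image_borel:
  "mp_homeo M X N Y f g \<Longrightarrow> E \<in> sets borel \<Longrightarrow> E \<subseteq> X \<Longrightarrow> f ` E \<in> sets borel"
  unfolding mp_homeo_def using homeomorphism_image_borel by blast

lemma mp_homeo_sym:
  assumes h: "mp_homeo M X N Y f g"
  shows "mp_homeo N Y M X g f"
  unfolding mp_homeo_def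
proof (intro conjI ballI impI)
  note D = mp_homeoD[OF h]
  show "homeomorphism Y X g f" using D(1) by (rule homeomorphism_symD)
  show "Y \<in> sets borel" "X \<in> sets borel" using D by auto
  fix E :: "'b set" assume E: "E \<in> sets borel" "E \<subseteq> Y"
  have "g ` E \<in> sets borel"
    using homeomorphism_image_borel[OF homeomorphism_symD[OF D(1)] D(3,2) E] .
  moreover have "g ` E \<subseteq> X" using E D(9) by blast
  moreover have "f ` g ` E = E" using E(2) D(11) by force
  ultimately show "emeasure M (g ` E) = emeasure N E"
    using mp_homeo_emeasure_image[OF h, of "g ` E"] by simp
qed

lemma mp_homeo_trans:
  assumes f: "mp_homeo M X N Y f g" and h: "mp_homeo N Y L Z h k"
  shows "mp_homeo M X L Z (\<lambda>x. h (f x)) (\<lambda>z. g (k z))"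
  unfolding mp_homeo_def
proof (intro conjI ballI impI)
  show "homeomorphism X Z (\<lambda>x. h (f x)) (\<lambda>z. g (k z))"
    using homeomorphism_compose[OF mp_homeoD(1)[OF f] mp_homeoD(1)[OF h]] by (simp add: o_def)
  show "X \<in> sets borel" "Z \<in> sets borel" using mp_homeoD[OF f] mp_homeoD[OF h] by auto
  fix E :: "'a set" assume E: "E \<in> sets borel" "E \<subseteq> X"
  have "f ` E \<in> sets borel" "f ` E \<subseteq> Y"
    using mp_homeo_image_borel[OF f E] mp_homeoD(8)[OF f] E by auto
  then show "emeasure L ((\<lambda>x. h (f x)) ` E) = emeasure M E"
    using mp_homeo_emeasure_image[OF h] mp_homeo_emeasure_image[OF f E]
    by (metis (no_types, lifting) image_image image_cong)
qed

lemma mp_homeo_subset: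
  assumes h: "mp_homeo M X N Y f g" and X': "X' \<in> sets borel" "X' \<subseteq> X" and Y': "f ` X' = Y'"
  shows "mp_homeo M X' N Y' f g"
  unfolding mp_homeo_def
proof (intro conjI ballI impI)
  show "homeomorphism X' Y' f g"
    by (rule homeomorphism_of_subsets[OF mp_homeoD(1)[OF h] X'(2) _ Y'])
      (use mp_homeoD(8)[OF h] X' Y' in \<open>auto\<close>)
  show "Y' \<in> sets borel" using mp_homeo_image_borel[OF h X'] Y' by simp
  show "emeasure N (f ` E) = emeasure M E" if "E \<in> sets borel" "E \<subseteq> X'" for E
    using mp_homeo_emeasure_image[OF h] that X' by blast
qed (use X' in auto)

lemma mp_homeo_refl: "X \<in> sets borel \<Longrightarrow> mp_homeo M X M X (\<lambda>x. x) (\<lambda>x. x)"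
  unfolding mp_homeo_def by (auto simp: homeomorphism_def)

text \<open>
  The images of the parts of a set in different pieces are disjoint, so the measures of the parts
  add up on both sides.
\<close>

lemma mp_homeo_glue:
  assumes P: "disjoint_family P" "\<And>n. openin (top_of_set X) (P n)"
    and Q: "disjoint_family Q" "\<And>n. openin (top_of_set Y) (Q n)"
    and h: "\<And>n. mp_homeo M (P n) N (Q n) (f n) (g n)"
    and M: "sets M = sets borel" and N: "sets N = sets borel"
  shows "mp_homeo M (\<Union>n. P n) N (\<Union>n. Q n) (glue P f) (glue Q g)"
  unfolding mp_homeo_def
proof (intro conjI ballI impI)
  show "homeomorphism (\<Union>n. P n) (\<Union>n. Q n) (glue P f) (glue Q g)"
    by (rule homeomorphism_glue[OF P Q mp_homeoD(1)[OF h]])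
  have PQ: "P n \<in> sets borel" "Q n \<in> sets borel" for n using mp_homeoD[OF h] by auto
  show "(\<Union>n. P n) \<in> sets borel" "(\<Union>n. Q n) \<in> sets borel"
    using PQ by (auto intro!: sets.countable_UN)
  fix E :: "'a set" assume E: "E \<in> sets borel" "E \<subseteq> (\<Union>n. P n)"
  have EP: "E \<inter> P n \<in> sets borel" for n using E PQ by auto
  have im: "glue P f ` E = (\<Union>n. f n ` (E \<inter> P n))" (is "?L = ?R")
  proof (intro equalityI subsetI)
    fix y assume "y \<in> ?L"
    then obtain x where x: "x \<in> E" "y = glue P f x" by blast
    then obtain n where "x \<in> P n" using E by blast
    then show "y \<in> ?R" using x glue_eq[OF P(1)] by blast
  next
    fix y assume "y \<in> ?R"
    then obtain n x where "x \<in> E" "x \<in> P n" "y = f n x" by blast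
    then show "y \<in> ?L" using glue_eq[OF P(1), of x n f] by (metis imageI)
  qed
  have "disjoint_family (\<lambda>n. f n ` (E \<inter> P n))"
    by (rule disjoint_family_subset[OF Q(1)]) (use mp_homeoD(8)[OF h] in blast)
  then have "emeasure N (\<Union>n. f n ` (E \<inter> P n)) = (\<Sum>n. emeasure N (f n ` (E \<inter> P n)))"
    using mp_homeo_image_borel[OF h EP] N by (intro suminf_emeasure[symmetric]) auto
  also have "\<dots> = (\<Sum>n. emeasure M (E \<inter> P n))"
    using mp_homeo_emeasure_image[OF h EP] by simp
  also have "\<dots> = emeasure M (\<Union>n. E \<inter> P n)"
    using EP M by (intro suminf_emeasure disjoint_family_subset[OF P(1)]) auto
  also have "(\<Union>n. E \<inter> P n) = E" using E by blast
  finally show "emeasure N (glue P f ` E) = emeasure M E" using im by simp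
qed

lemma mp_homeo_imp_measure_preserving:
  assumes h: "mp_homeo M X N Y f g" and M: "sets M = sets borel" and N: "sets N = sets borel"
  shows "measure_preserving (restrict_space M X) (restrict_space N Y) f"
  unfolding measure_preserving_def
proof
  note D = mp_homeoD[OF h]
  have sp: "space M = UNIV" "space N = UNIV"
    using sets_eq_imp_space_eq[OF M] sets_eq_imp_space_eq[OF N] by simp_all
  have pre: "f -` E \<inter> X = g ` (E \<inter> Y)" for E
  proof (intro equalityI subsetI)
    fix x assume "x \<in> f -` E \<inter> X"
    then have "x = g (f x)" "f x \<in> E \<inter> Y" using D(8,10) by auto
    then show "x \<in> g ` (E \<inter> Y)" by blast
  qed (use D(9,11) in auto)
  have meas: "g ` (E \<inter> Y) \<in> sets borel" if "E \<in> sets borel" for E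
    using mp_homeo_image_borel[OF mp_homeo_sym[OF h], of "E \<inter> Y"] that D(3) by auto
  show "f \<in> measurable (restrict_space M X) (restrict_space N Y)"
  proof (rule measurableI)
    show "f x \<in> space (restrict_space N Y)" if "x \<in> space (restrict_space M X)" for x
      using that D(8) by (auto simp: space_restrict_space sp)
    fix E assume E: "E \<in> sets (restrict_space N Y)"
    then have E': "E \<in> sets borel" "E \<subseteq> Y"
      using D(3) N by (auto simp: sets_restrict_space_iff sp)
    have "f -` E \<inter> X \<in> sets borel" using pre meas E' by simp
    then show "f -` E \<inter> space (restrict_space M X) \<in> sets (restrict_space M X)"
      using M D(2) by (auto simp: sets_restrict_space_iff space_restrict_space sp)
  qed
  show "\<forall>E\<in>sets (restrict_space N Y).
      emeasure (restrict_space M X) (f -` E \<inter> space (restrict_space M X)) =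
      emeasure (restrict_space N Y) E"
  proof
    fix E assume E: "E \<in> sets (restrict_space N Y)"
    then have E': "E \<in> sets borel" "E \<subseteq> Y"
      using D(3) N by (auto simp: sets_restrict_space_iff sp)
    have "emeasure M (f -` E \<inter> X) = emeasure N E"
      using mp_homeo_emeasure_image[OF mp_homeo_sym[OF h] E'] pre[of E] E'(2)
      by (simp add: Int_absorb2)
    then show "emeasure (restrict_space M X) (f -` E \<inter> space (restrict_space M X)) =
      emeasure (restrict_space N Y) E"
      using D(2,3) M N E' by (simp add: emeasure_restrict_space space_restrict_space sp)
  qed
qed

lemma mp_homeoI_vimage:
  assumes h: "homeomorphism X Y f g" and XY: "X \<in> sets borel" "Y \<in> sets borel"
    and m: "\<And>E. E \<in> sets borel \<Longrightarrow> E \<subseteq> Y \<Longrightarrow> emeasure M (f -` E \<inter> X) = emeasure N E"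
  shows "mp_homeo M X N Y f g"
  unfolding mp_homeo_def
proof (intro conjI ballI impI)
  fix E :: "'a set" assume E: "E \<in> sets borel" "E \<subseteq> X"
  have "f -` (f ` E) \<inter> X = E"
    using h E(2) unfolding homeomorphism_def by auto (metis subsetD)
  moreover have "f ` E \<in> sets borel" "f ` E \<subseteq> Y"
    using homeomorphism_image_borel[OF h XY E] h E(2) by (auto simp: homeomorphism_def)
  ultimately show "emeasure N (f ` E) = emeasure M E" using m[of "f ` E"] by simp
qed (use h XY in auto)

text \<open>
  Both normalizing factors are the reciprocal of the same positive finite number, so they cancel.
\<close>

lemma mp_homeo_of_normalized:
  assumes h: "homeomorphism A B \<phi> \<psi>" and A: "A \<in> sets borel" and B: "B \<in> sets borel"
    and M: "sets M = sets borel" "prob_space M" and N: "sets N = sets borel"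
    and eq: "emeasure M A = emeasure N B" and pos: "0 < emeasure M A"
    and mp: "measure_preserving (normalized_restriction M A) (normalized_restriction N B) \<phi>"
  shows "mp_homeo M A N B \<phi> \<psi>"
proof (rule mp_homeoI_vimage[OF h A B])
  fix C assume C: "C \<in> sets borel" "C \<subseteq> B"
  have sp: "space M = UNIV" "space N = UNIV"
    using sets_eq_imp_space_eq[OF M(1)] sets_eq_imp_space_eq[OF N] by simp_all
  have fin: "emeasure M A \<noteq> \<infinity>"
    using prob_space.finite_measure[OF M(2)] by (simp add: finite_measure.emeasure_finite)
  have setsA: "F \<in> sets (restrict_space M A) \<longleftrightarrow> F \<in> sets borel \<and> F \<subseteq> A" for F
    using A M by (auto simp: sets_restrict_space_iff sp)
  have setsB: "F \<in> sets (restrict_space N B) \<longleftrightarrow> F \<in> sets borel \<and> F \<subseteq> B" for F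
    using B N by (auto simp: sets_restrict_space_iff sp)
  have em: "emeasure (normalized_restriction M A) F = emeasure M F / emeasure M A"
    if "F \<in> sets borel" "F \<subseteq> A" for F
    unfolding normalized_restriction_def
    using that A M setsA
    by (subst emeasure_uniform_measure) (auto simp: emeasure_restrict_space sp Int_absorb1)
  have em': "emeasure (normalized_restriction N B) F = emeasure N F / emeasure N B"
    if "F \<in> sets borel" "F \<subseteq> B" for F
    unfolding normalized_restriction_def
    using that B N setsB
    by (subst emeasure_uniform_measure) (auto simp: emeasure_restrict_space sp Int_absorb1)
  have spA: "space (normalized_restriction M A) = A"
    by (simp add: normalized_restriction_def space_restrict_space sp)
  have "C \<in> sets (normalized_restriction N B)"
    using C setsB by (simp add: normalized_restriction_def)
  then have "emeasure (normalized_restriction M A) (\<phi> -` C \<inter> A) = emeasure (normalized_restriction N B) C"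
    using mp spA unfolding measure_preserving_def by metis
  moreover have "\<phi> -` C \<inter> A = \<psi> ` C"
  proof (intro equalityI subsetI)
    fix x assume "x \<in> \<phi> -` C \<inter> A"
    then have "x = \<psi> (\<phi> x)" "\<phi> x \<in> C" using h by (auto simp: homeomorphism_def)
    then show "x \<in> \<psi> ` C" by blast
  qed (use h C in \<open>auto simp: homeomorphism_def\<close>)
  moreover have "\<psi> ` C \<in> sets borel" "\<psi> ` C \<subseteq> A"
    using homeomorphism_image_borel[OF homeomorphism_symD[OF h] B A C] h C
    by (auto simp: homeomorphism_def)
  ultimately have "emeasure M (\<phi> -` C \<inter> A) / emeasure M A = emeasure N C / emeasure M A"
    using em em' C eq by simp
  then have "emeasure M (\<phi> -` C \<inter> A) / emeasure M A * emeasure M A =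
      emeasure N C / emeasure M A * emeasure M A" by simp
  then show "emeasure M (\<phi> -` C \<inter> A) = emeasure N C"
    using pos fin by (simp add: ennreal_divide_times ennreal_times_divide[symmetric] top.not_eq_extremum)
qed

section \<open>Removing invariant null sets from a carrier\<close>

lemma gdelta_iff_gdelta_in:
  fixes S :: "'a::topological_space set"
  shows "gdelta S \<longleftrightarrow> gdelta_in euclidean S"
proof
  assume "gdelta S"
  then show "gdelta_in euclidean S"
  proof (cases rule: gdelta.cases)
    case (1 F)
    show ?thesis unfolding 1(1)
      by (rule gdelta_in_Inter) (use 1(2) in \<open>auto intro: open_imp_gdelta_in\<close>)
  qed
next
  assume "gdelta_in euclidean S"
  then obtain C :: "nat \<Rightarrow> 'a set" where C: "\<And>n. openin euclidean (C n)" "\<Inter>(range C) = S"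
    unfolding gdelta_in_descending by metis
  then have "\<And>n. open (C n)" by simp
  then show "gdelta S" using gdelta.intros[of C] C(2) by simp
qed

lemma gdelta_borel: "gdelta S \<Longrightarrow> S \<in> sets borel"
  by (erule gdelta.cases) (auto intro!: sets.countable_INT)

text \<open>
  The sets that may be discarded from a nearly full set \<open>X\<close>. They are relative \<open>F\<^sub>\<sigma>\<close> sets, and not
  merely closed, because making a set invariant under the dynamics takes countable unions.
\<close>

definition null_fsigma :: "'a::topological_space measure \<Rightarrow> 'a set \<Rightarrow> 'a set \<Rightarrow> bool" where
  "null_fsigma M X F \<longleftrightarrow> F \<in> null_sets M \<and> fsigma_in (top_of_set X) F"

lemma null_fsigma_subset: "null_fsigma M X F \<Longrightarrow> F \<subseteq> X"
  unfolding null_fsigma_def using fsigma_in_subset by fastforce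

lemma null_fsigma_UN:
  fixes F :: "nat \<Rightarrow> 'a::topological_space set"
  shows "(\<And>n. null_fsigma M X (F n)) \<Longrightarrow> null_fsigma M X (\<Union>n. F n)"
  unfolding null_fsigma_def by (auto intro!: fsigma_in_Union)

lemma null_fsigma_Un:
  "null_fsigma M X F \<Longrightarrow> null_fsigma M X G \<Longrightarrow> null_fsigma M X (F \<union> G)"
  unfolding null_fsigma_def by (auto intro!: fsigma_in_Un null_sets.Un)

lemma nearly_full_diff_null_fsigma:
  assumes "nearly_full M X" "null_fsigma M X F" "sets M = sets borel"
  shows "nearly_full M (X - F)"
proof -
  have X: "gdelta X" "emeasure M X = 1" using assms by (auto simp: nearly_full_def)
  have "gdelta_in (top_of_set X) (X - F)"
    using assms(2) gdelta_in_diff[OF gdelta_in_topspace, of "top_of_set X" F]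
    by (simp add: null_fsigma_def)
  then have "gdelta (X - F)"
    using X(1) gdelta_in_gdelta_subtopology unfolding gdelta_iff_gdelta_in by blast
  moreover have "emeasure M (X - F) = emeasure M X"
    using assms(2,3) gdelta_borel[OF X(1)] by (intro emeasure_Diff_null_set) (auto simp: null_fsigma_def)
  ultimately show ?thesis using X by (simp add: nearly_full_def)
qed

text \<open>
  Because \<open>A\<close> and \<open>B\<close> are closed in \<open>X\<close> and \<open>Y\<close>, passing to the trace on \<open>A\<close>, transporting it and
  regarding the result as a subset of \<open>Y\<close> all preserve being a relative \<open>F\<^sub>\<sigma>\<close> set.
\<close>

lemma null_fsigma_image:
  assumes h: "mp_homeo M A N B f g"
    and A: "closedin (top_of_set X) A" and B: "closedin (top_of_set Y) B"
    and F: "null_fsigma M X F" and M: "sets M = sets borel" and N: "sets N = sets borel"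
  shows "null_fsigma N Y (f ` (F \<inter> A))"
proof -
  have "fsigma_in (top_of_set X) (F \<inter> A)"
    using F A by (auto simp: null_fsigma_def intro: fsigma_in_Int closed_imp_fsigma_in)
  then have "fsigma_in (subtopology (top_of_set X) A) (F \<inter> A)"
    by (subst fsigma_in_fsigma_subtopology) (auto intro: A closed_imp_fsigma_in)
  moreover have "subtopology (top_of_set X) A = top_of_set A"
    using closedin_imp_subset[OF A] by (simp add: subtopology_subtopology Int_absorb1)
  ultimately have "fsigma_in (top_of_set A) (F \<inter> A)" by simp
  moreover have "homeomorphic_map (top_of_set A) (top_of_set B) f"
    using mp_homeoD(1)[OF h] homeomorphic_map_maps homeomorphic_maps_def
    unfolding homeomorphism_def by (force simp: homeomorphic_maps_def homeomorphic_map_maps)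
  ultimately have "fsigma_in (top_of_set B) (f ` (F \<inter> A))"
    by (subst homeomorphic_map_fsigmaness[where X = "top_of_set A"]) auto
  moreover have "subtopology (top_of_set Y) B = top_of_set B"
    using closedin_imp_subset[OF B] by (simp add: subtopology_subtopology Int_absorb1)
  ultimately have fs: "fsigma_in (top_of_set Y) (f ` (F \<inter> A))"
    using fsigma_in_fsigma_subtopology[OF closed_imp_fsigma_in[OF B], of "f ` (F \<inter> A)"] by simp
  have FA: "F \<inter> A \<in> null_sets M" "F \<inter> A \<in> sets borel"
    using F M mp_homeoD(2)[OF h] by (auto simp: null_fsigma_def intro: null_set_Int2)
  then have "emeasure N (f ` (F \<inter> A)) = 0" "f ` (F \<inter> A) \<in> sets borel"
    using mp_homeo_emeasure_image[OF h, of "F \<inter> A"] mp_homeo_image_borel[OF h, of "F \<inter> A"] by auto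
  then show ?thesis using fs N by (auto simp: null_fsigma_def)
qed

section \<open>Iterates and recurrence in a nearly continuous system\<close>

locale nc_dynamics =
  fixes M :: "'a::polish_space measure" and D :: "'a set" and T :: "'a \<Rightarrow> 'a"
  assumes sys: "nc_system M D T"
begin

lemma sets_M: "sets M = sets borel"
  using sys by (simp add: nc_system_def polish_prob_space_def)

lemma space_M: "space M = UNIV"
  using sets_eq_imp_space_eq[OF sets_M] by simp

lemma prob: "prob_space M"
  using sys by (simp add: nc_system_def polish_prob_space_def)

lemma nearly_full_D: "nearly_full M D"
  using sys by (simp add: nc_system_def)

lemma borel_D: "D \<in> sets borel"
  using nearly_full_D gdelta_borel by (auto simp: nearly_full_def)

text \<open>
  The inverse provided by the definition of a system agrees on \<open>D\<close> with \<open>inv_into D T\<close>, in terms of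
  which the negative iterates are defined.
\<close>

lemma mp_homeo_T: "mp_homeo M D M D T (inv_into D T)"
proof -
  obtain g where g: "homeomorphism D D T g"
    using sys by (auto simp: nc_system_def homeo_betw_def)
  have gD: "\<And>x. x \<in> D \<Longrightarrow> g (T x) = x" "\<And>y. y \<in> D \<Longrightarrow> g y \<in> D"
    "\<And>y. y \<in> D \<Longrightarrow> T (g y) = y"
    using g unfolding homeomorphism_def by auto
  have "inj_on T D" using gD(1) by (rule inj_on_inverseI)
  then have "inv_into D T y = g y" if "y \<in> D" for y
    using gD(2,3)[OF that] by (rule inv_into_f_eq)
  then have "homeomorphism D D T (inv_into D T)"
    by (intro homeomorphism_cong[OF g]) auto
  moreover have "emeasure M (T -` E \<inter> D) = emeasure M E" if "E \<in> sets borel" "E \<subseteq> D" for E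
  proof -
    have mp: "measure_preserving (restrict_space M D) (restrict_space M D) T"
      using sys by (simp add: nc_system_def)
    have "E \<in> sets (restrict_space M D)"
      using that sets_M borel_D by (simp add: sets_restrict_space_iff space_M)
    then have "emeasure (restrict_space M D) (T -` E \<inter> D) = emeasure (restrict_space M D) E"
      using mp unfolding measure_preserving_def by (simp add: space_restrict_space space_M)
    then show ?thesis
      using that borel_D by (simp add: emeasure_restrict_space space_M sets_M)
  qed
  ultimately show ?thesis by (intro mp_homeoI_vimage borel_D)
qed

lemmas T_D = mp_homeoD[OF mp_homeo_T]

lemma mp_homeo_funpow: "mp_homeo M D M D (T ^^ n) (inv_into D T ^^ n)"
proof (induction n)
  case 0
  then show ?case using mp_homeo_refl[OF borel_D] by (simp add: id_def)
next
  case (Suc n)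
  from mp_homeo_trans[OF this mp_homeo_T] show ?case
    by (simp add: o_def funpow_swap1)
qed

abbreviation P :: "int \<Rightarrow> 'a \<Rightarrow> 'a" where "P \<equiv> int_iter D T"

lemma mp_homeo_P: "mp_homeo M D M D (P i) (P (- i))"
proof -
  consider n where "i = int n" "n > 0" | n where "i = - int n"
    by (metis int_cases2 of_nat_0_less_iff neq0_conv minus_zero of_nat_0)
  then show ?thesis
  proof cases
    case (1 n)
    then show ?thesis using mp_homeo_funpow[of n] by (simp add: int_iter_def)
  next
    case (2 n)
    then show ?thesis using mp_homeo_sym[OF mp_homeo_funpow[of n]] 
      by (cases "n = 0") (simp_all add: int_iter_def)
  qed
qed

lemma P_0 [simp]: "P 0 x = x" by (simp add: int_iter_def)
lemma P_1 [simp]: "P 1 x = T x" by (simp add: int_iter_def)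
lemma P_nat: "P (int n) x = (T ^^ n) x" by (simp add: int_iter_def)
lemma P_in_D: "x \<in> D \<Longrightarrow> P i x \<in> D" using mp_homeoD(8)[OF mp_homeo_P] .

lemma P_Suc: assumes "x \<in> D" shows "P (i + 1) x = T (P i x)"
proof (cases "0 \<le> i")
  case True
  then show ?thesis by (simp add: int_iter_def nat_add_distrib)
next
  case False
  define n where "n = nat (- i) - 1"
  have i: "i = - int n - 1" using False by (simp add: n_def)
  have "(inv_into D T ^^ n) x \<in> D" using mp_homeoD(9)[OF mp_homeo_funpow assms] .
  then show ?thesis using T_D(11) by (auto simp: i int_iter_def nat_diff_distrib nat_add_distrib)
qed

lemma P_pred: assumes "x \<in> D" shows "P (i - 1) x = inv_into D T (P i x)"
  using P_Suc[OF assms, of "i - 1"] T_D(10)[OF P_in_D[OF assms, of "i - 1"]] by simp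

lemma P_add: assumes x: "x \<in> D" shows "P (i + j) x = P i (P j x)"
proof (induction i rule: int_induct[where k = 0])
  case (step1 i)
  then show ?case using P_Suc[OF x, of "i + j"] P_Suc[OF P_in_D[OF x], of i j] by (simp add: ac_simps)
next
  case (step2 i)
  then show ?case using P_pred[OF x, of "i + j"] P_pred[OF P_in_D[OF x], of i j] by (simp add: algebra_simps)
qed simp

lemma orb_P: assumes x: "x \<in> D" shows "orb D T (P i x) = orb D T x"
proof -
  have "P j (P i x) \<in> range (\<lambda>j. P j x)" "P j x \<in> range (\<lambda>j. P j (P i x))" for j
    using P_add[OF x, of j i] P_add[OF x, of "j - i" i] by (auto intro: range_eqI[where x = "j + i"])
  then show ?thesis unfolding orb_def by blast
qed

lemma carrier_sub: "carrier_of M D T X \<Longrightarrow> X \<subseteq> D" by (simp add: carrier_of_def)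

lemma carrier_borel: "carrier_of M D T X \<Longrightarrow> X \<in> sets borel"
  using gdelta_borel by (auto simp: carrier_of_def nearly_full_def)

lemma P_carrier: assumes X: "carrier_of M D T X" and x: "x \<in> X" shows "P i x \<in> X"
proof -
  have XD: "X \<subseteq> D" and TX: "T ` X = X" using X by (auto simp: carrier_of_def)
  show ?thesis
  proof (induction i rule: int_induct[where k = 0])
    case (step1 i)
    then show ?case using P_Suc[of x i] x XD TX by auto
  next
    case (step2 i)
    then obtain z where z: "z \<in> X" "P i x = T z" using TX by blast
    then have "P (i - 1) x = z" using P_pred[of x i] subsetD[OF XD] x T_D(10)[of z] by simp
    then show ?case using z by simp
  qed (use x in simp)
qed

lemma P_image_carrier: assumes X: "carrier_of M D T X" shows "P i ` X = X"
proof
  show "P i ` X \<subseteq> X" using P_carrier[OF X] by blast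
  show "X \<subseteq> P i ` X"
  proof
    fix x assume x: "x \<in> X"
    then have "P i (P (- i) x) = x" using P_add[of x i "- i"] carrier_sub[OF X] by auto
    then show "x \<in> P i ` X" using P_carrier[OF X x, of "- i"] by (metis imageI)
  qed
qed

lemma mp_homeo_carrier: "carrier_of M D T X \<Longrightarrow> mp_homeo M X M X (P i) (P (- i))"
  using mp_homeo_subset[OF mp_homeo_P carrier_borel carrier_sub P_image_carrier] .

lemma nearly_full_Compl_null:
  assumes "nearly_full M X" shows "- X \<in> null_sets M"
proof -
  have X: "X \<in> sets M" "emeasure M X = 1"
    using assms gdelta_borel sets_M by (auto simp: nearly_full_def)
  have "emeasure M (space M - X) = emeasure M (space M) - emeasure M X"
    using X by (intro emeasure_compl) auto
  then have "emeasure M (- X) = 0"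
    using prob_space.emeasure_space_1[OF prob] X by (simp add: space_M Compl_eq_Diff_UNIV)
  then show ?thesis using X by (auto simp: space_M sets_M)
qed

lemma emeasure_Int_nearly_full:
  assumes "nearly_full M X" "C \<in> sets M"
  shows "emeasure M (C \<inter> X) = emeasure M C"
  using emeasure_Diff_null_set[OF nearly_full_Compl_null[OF assms(1)] assms(2)]
  by (simp add: Diff_eq)

text \<open>
  A nearly clopen set need not be Borel, but it differs from its trace on a suitable carrier by a
  subset of a null set.
\<close>

lemma emeasure_completion_nearly_full:
  assumes X: "nearly_full M X" and C: "C \<inter> X \<in> sets M"
  shows "emeasure (completion M) C = emeasure M (C \<inter> X)"
proof -
  have "- X \<in> null_sets M" by (rule nearly_full_Compl_null[OF X])
  then have n: "C - X \<in> null_sets (completion M)"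
    unfolding null_sets_completion_iff2 by (intro bexI[of _ "- X"]) auto
  have "emeasure (completion M) ((C \<inter> X) \<union> (C - X)) = emeasure (completion M) (C \<inter> X)"
    using C n by (intro emeasure_Un_null_set) auto
  moreover have "(C \<inter> X) \<union> (C - X) = C" by blast
  ultimately show ?thesis using C by (simp add: emeasure_completion)
qed

lemma T_carrier: "carrier_of M D T X \<Longrightarrow> x \<in> X \<Longrightarrow> T x \<in> X"
  using P_carrier[of X x 1] by simp

lemma funpow_carrier: "carrier_of M D T X \<Longrightarrow> x \<in> X \<Longrightarrow> (T ^^ n) x \<in> X"
  using P_carrier[of X x "int n"] by (simp add: P_nat)

lemma T_carrier_iff:
  assumes X: "carrier_of M D T X" and x: "x \<in> D"
  shows "T x \<in> X \<longleftrightarrow> x \<in> X"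
proof
  assume "T x \<in> X"
  then have "P (- 1) (T x) \<in> X" by (rule P_carrier[OF X])
  then show "x \<in> X" using P_add[OF x, of "- 1" 1] by simp
qed (rule T_carrier[OF X])

lemma mp_homeo_funpow_carrier:
  "carrier_of M D T X \<Longrightarrow> mp_homeo M X M X (T ^^ n) (P (- int n))"
  using mp_homeo_carrier[of X "int n"] unfolding P_nat[abs_def] .

lemma ergodic:
  "C \<in> sets M \<Longrightarrow> C \<subseteq> D \<Longrightarrow> T -` C \<inter> D = C \<Longrightarrow> emeasure M C = 0 \<or> emeasure M C = 1"
  using sys by (simp add: nc_system_def)

text \<open>
  Poincare recurrence combined with ergodicity. The sets \<open>V k\<close> of points that visit \<open>F\<close> at some time
  \<open>n \<ge> k\<close> decrease, and \<open>V k\<close> is the preimage of \<open>V 0\<close> under \<open>T\<^sup>k\<close>, so all of them, and hence their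
  intersection, have the measure of \<open>V 0\<close>. The intersection is invariant and \<open>V 0\<close> contains \<open>F\<close>, so
  this measure is positive and therefore equal to one.
\<close>

lemma frequent_visits_full:
  assumes X: "carrier_of M D T X" and F: "F \<in> sets borel" "F \<subseteq> X" "0 < emeasure M F"
  shows "{x\<in>X. \<forall>k. \<exists>n\<ge>k. (T ^^ n) x \<in> F} \<in> sets borel"
    and "emeasure M {x\<in>X. \<forall>k. \<exists>n\<ge>k. (T ^^ n) x \<in> F} = 1"
proof -
  define V where "V k = {x\<in>X. \<exists>n\<ge>k. (T ^^ n) x \<in> F}" for k :: nat
  define Z where "Z = (\<Inter>k. V k)"
  have XD: "X \<subseteq> D" using carrier_sub[OF X] .
  have pre: "{x\<in>X. (T ^^ k) x \<in> W} = P (- int k) ` W" if "W \<subseteq> X" for W k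
  proof (intro equalityI subsetI)
    fix x assume "x \<in> {x\<in>X. (T ^^ k) x \<in> W}"
    then have "P (- int k) ((T ^^ k) x) = x" "(T ^^ k) x \<in> W"
      using mp_homeoD(10)[OF mp_homeo_funpow_carrier[OF X]] by auto
    then show "x \<in> P (- int k) ` W" by (metis imageI)
  next
    fix x assume "x \<in> P (- int k) ` W"
    then obtain w where "w \<in> W" "x = P (- int k) w" by blast
    then show "x \<in> {x\<in>X. (T ^^ k) x \<in> W}"
      using mp_homeoD(9,11)[OF mp_homeo_funpow_carrier[OF X]] that by auto
  qed
  have im: "P i ` W \<in> sets borel" "emeasure M (P i ` W) = emeasure M W"
    if "W \<in> sets borel" "W \<subseteq> X" for W i
    using mp_homeo_image_borel[OF mp_homeo_carrier[OF X]] that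
      mp_homeo_emeasure_image[OF mp_homeo_carrier[OF X]] by auto
  have "V 0 = (\<Union>n. {x\<in>X. (T ^^ n) x \<in> F})" by (auto simp: V_def)
  also have "\<dots> \<in> sets borel"
    using im(1)[OF F(1,2)] pre[OF F(2)] by (auto intro!: sets.countable_UN)
  finally have V0: "V 0 \<in> sets borel" "V 0 \<subseteq> X" by (auto simp: V_def)
  have Vk: "V k = P (- int k) ` V 0" for k
  proof -
    have "V k = {x\<in>X. (T ^^ k) x \<in> V 0}"
    proof (intro equalityI subsetI)
      fix x assume "x \<in> V k"
      then obtain n where n: "x \<in> X" "k \<le> n" "(T ^^ n) x \<in> F" by (auto simp: V_def)
      then have "(T ^^ (n - k)) ((T ^^ k) x) \<in> F" by (metis funpow_add le_add_diff_inverse2 o_apply)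
      then show "x \<in> {x\<in>X. (T ^^ k) x \<in> V 0}"
        using n funpow_carrier[OF X n(1)] by (auto simp: V_def)
    next
      fix x assume "x \<in> {x\<in>X. (T ^^ k) x \<in> V 0}"
      then obtain n where "x \<in> X" "(T ^^ n) ((T ^^ k) x) \<in> F" by (auto simp: V_def)
      then have "(T ^^ (n + k)) x \<in> F" by (simp add: funpow_add)
      with \<open>x \<in> X\<close> show "x \<in> V k" unfolding V_def by (auto intro!: exI[of _ "n + k"])
    qed
    then show ?thesis using pre[OF V0(2)] by simp
  qed
  have Vm: "V k \<in> sets borel" "emeasure M (V k) = emeasure M (V 0)" for k
    unfolding Vk[of k] using im V0 by auto
  have "decseq V"
    unfolding decseq_def V_def by (auto intro: order_trans)
  then have "(INF k. emeasure M (V k)) = emeasure M Z"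
    unfolding Z_def using Vm prob_space.finite_measure[OF prob]
    by (intro INF_emeasure_decseq) (auto simp: sets_M finite_measure.emeasure_finite)
  moreover have "range (\<lambda>k. emeasure M (V k)) = {emeasure M (V 0)}"
    using Vm(2) by blast
  ultimately have "emeasure M Z = emeasure M (V 0)" by (metis cInf_singleton)
  moreover have "emeasure M F \<le> emeasure M (V 0)"
    using F V0 sets_M by (intro emeasure_mono) (auto simp: V_def intro!: exI[of _ 0])
  ultimately have Z0: "emeasure M Z \<noteq> 0" using F(3) by auto
  have Zm: "Z \<in> sets borel" unfolding Z_def using Vm(1) by (auto intro!: sets.countable_INT)
  have Zeq: "Z = {x\<in>X. \<forall>k. \<exists>n\<ge>k. (T ^^ n) x \<in> F}" by (auto simp: Z_def V_def)
  \<comment> \<open>Frequent visits do not depend on where on its orbit a point starts.\<close>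
  have step: "(\<forall>k. \<exists>n\<ge>k. (T ^^ n) (T x) \<in> F) \<longleftrightarrow> (\<forall>k. \<exists>n\<ge>k. (T ^^ n) x \<in> F)" for x
  proof -
    have "(T ^^ n) (T x) = (T ^^ Suc n) x" for n by (simp add: funpow_swap1)
    then show ?thesis by (metis Suc_le_D Suc_le_mono le_Suc_eq nat_le_linear)
  qed
  have TZ: "T -` Z \<inter> D = Z"
    unfolding Zeq using T_carrier_iff[OF X] XD step by auto
  have "Z \<subseteq> D" using XD unfolding Zeq by blast
  then have "emeasure M Z = 0 \<or> emeasure M Z = 1"
    using ergodic[of Z] Zm TZ sets_M by simp
  with Z0 have "emeasure M Z = 1" by simp
  then show "emeasure M {x\<in>X. \<forall>k. \<exists>n\<ge>k. (T ^^ n) x \<in> F} = 1" unfolding Zeq .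
  show "{x\<in>X. \<forall>k. \<exists>n\<ge>k. (T ^^ n) x \<in> F} \<in> sets borel" using Zm unfolding Zeq .
qed

text \<open>
  For relatively open \<open>F\<close>, staying out of \<open>F\<close> from time \<open>k\<close> on is a closed condition, and the
  exceptional points are those that satisfy it for some \<open>k\<close>.
\<close>

lemma infrequent_visits_null_fsigma:
  assumes X: "carrier_of M D T X" and F: "F \<in> sets borel" "0 < emeasure M F"
    "openin (top_of_set X) F"
  shows "null_fsigma M X {x\<in>X. \<not> (\<forall>k. \<exists>n\<ge>k. (T ^^ n) x \<in> F)}" (is "null_fsigma M X ?W")
proof -
  define Z where "Z = {x\<in>X. \<forall>k. \<exists>n\<ge>k. (T ^^ n) x \<in> F}"
  have FX: "F \<subseteq> X" using F(3) openin_imp_subset by blast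
  note full = frequent_visits_full[OF X F(1) FX F(2), folded Z_def]
  have Z: "Z \<in> sets M" "emeasure M Z = 1"
    using full sets_M by simp_all
  have "X \<in> sets M" "emeasure M X = 1"
    using carrier_borel[OF X] X by (simp_all add: sets_M carrier_of_def nearly_full_def)
  moreover have "Z \<subseteq> X" unfolding Z_def by blast
  ultimately have "emeasure M (X - Z) = 1 - 1" "X - Z \<in> sets M"
    using emeasure_Diff[of M Z X] Z by simp_all
  then have "X - Z \<in> null_sets M" by (simp add: null_sets_def)
  have "X - {x\<in>X. Q x} = {x\<in>X. \<not> Q x}" for Q by blast
  then have W: "X - Z = ?W" unfolding Z_def .
  have "?W \<in> null_sets M" using \<open>X - Z \<in> null_sets M\<close> unfolding W .
  moreover have "fsigma_in (top_of_set X) ?W"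
  proof -
    have c: "closedin (top_of_set X) {x\<in>X. (T ^^ n) x \<notin> F}" for n
    proof -
      have "closedin (top_of_set X) (X \<inter> (T ^^ n) -` (X - F))"
        using mp_homeoD(4,8)[OF mp_homeo_funpow_carrier[OF X, of n]] F(3)
        by (intro continuous_closedin_preimage_gen[where T = X]) auto
      moreover have "X \<inter> (T ^^ n) -` (X - F) = {x\<in>X. (T ^^ n) x \<notin> F}"
        using funpow_carrier[OF X] by auto
      ultimately show ?thesis by simp
    qed
    have W_UN: "?W = (\<Union>k. \<Inter>n\<in>{k..}. {x\<in>X. (T ^^ n) x \<notin> F})"
      by auto
    have "closedin (top_of_set X) (\<Inter>n\<in>{k..}. {x\<in>X. (T ^^ n) x \<notin> F})" for k
      using c by (intro closedin_INT) auto
    then show ?thesis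
      unfolding W_UN by (intro fsigma_in_Union) (auto intro: closed_imp_fsigma_in simp del: INT_simps)
  qed
  ultimately show ?thesis by (simp add: null_fsigma_def)
qed

lemma carrier_diff_null_fsigma:
  assumes X: "carrier_of M D T X" and F: "null_fsigma M X F"
    and inv: "T ` F \<subseteq> F" "P (- 1) ` F \<subseteq> F"
  shows "carrier_of M D T (X - F)"
proof -
  have "T ` (X - F) = X - F"
  proof (intro equalityI subsetI)
    fix y assume "y \<in> T ` (X - F)"
    then obtain x where x: "x \<in> X" "x \<notin> F" "y = T x" by blast
    then have "P (- 1) y = x" using P_add[of x "- 1" 1] carrier_sub[OF X] by auto
    then have "y \<notin> F" using x(2) inv(2) by (metis image_subset_iff)
    then show "y \<in> X - F" using x T_carrier[OF X] by simp
  next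
    fix y assume y: "y \<in> X - F"
    then have *: "T (P (- 1) y) = y" using P_add[of y 1 "- 1"] carrier_sub[OF X] by auto
    then have "P (- 1) y \<notin> F" using y inv(1) by (metis DiffD2 image_subset_iff)
    then show "y \<in> T ` (X - F)" using * P_carrier[OF X, of y "- 1"] y by (metis DiffD1 DiffI imageI)
  qed
  then show ?thesis
    using X nearly_full_diff_null_fsigma[OF _ F sets_M] by (auto simp: carrier_of_def)
qed

end

section \<open>Two systems with a conjugacy between clopen subsets\<close>

text \<open>
  No relation between \<open>\<phi>\<close> and the dynamics is imposed yet. The induced maps are defined everywhere
  only after a null set has been removed from the carriers, and the removal takes place here.
\<close>

locale induced_pair = X: nc_dynamics M D T + Y: nc_dynamics N E S
  for M :: "'a::polish_space measure" and D T and N :: "'b::polish_space measure" and E S +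
  fixes X A :: "'a set" and Y B :: "'b set" and \<phi> :: "'a \<Rightarrow> 'b" and \<psi> :: "'b \<Rightarrow> 'a"
  assumes carrier_X: "carrier_of M D T X" and carrier_Y: "carrier_of N E S Y"
    and clopen_A: "clopen_in X A" and clopen_B: "clopen_in Y B"
    and mp_\<phi>: "mp_homeo M A N B \<phi> \<psi>"
    and pos_A: "0 < emeasure M A"
begin

lemmas \<phi>_D = mp_homeoD[OF mp_\<phi>]

lemma A_sub: "A \<subseteq> X" and B_sub: "B \<subseteq> Y"
  using clopen_A clopen_B by (auto simp: clopen_in_iff_locally_constant_on)

lemma pos_B: "0 < emeasure N B"
  using mp_homeo_emeasure_image[OF mp_\<phi> \<phi>_D(2)] \<phi>_D(6) pos_A by simp

text \<open>
  The sets \<open>F\<close> and \<open>H\<close> are enlarged by their images under \<open>T\<close>, \<open>S\<close>, \<open>\<phi>\<close> and the inverses of these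
  maps. After countably many rounds the sets are closed under all of these maps and still null, so
  their complements are carriers, and \<open>\<phi>\<close> restricts to a bijection between the traces of \<open>A\<close> and
  \<open>B\<close> on them.
\<close>

lemma saturate:
  assumes F: "null_fsigma M X F" and H: "null_fsigma N Y H"
  obtains X' Y' where "carrier_of M D T X'" "carrier_of N E S Y'"
    "X' \<subseteq> X - F" "Y' \<subseteq> Y - H" "\<phi> ` (A \<inter> X') = B \<inter> Y'"
proof -
  define step where "step = (\<lambda>(F, H).
    (F \<union> T ` F \<union> X.P (- 1) ` F \<union> \<psi> ` (H \<inter> B), H \<union> S ` H \<union> Y.P (- 1) ` H \<union> \<phi> ` (F \<inter> A)))"
  define w where "w n = (step ^^ n) (F, H)" for n
  define F' where "F' n = fst (w n)" for n
  define H' where "H' n = snd (w n)" for n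
  have w0: "F' 0 = F" "H' 0 = H" by (simp_all add: F'_def H'_def w_def)
  have wS: "F' (Suc n) = F' n \<union> T ` F' n \<union> X.P (- 1) ` F' n \<union> \<psi> ` (H' n \<inter> B)"
    "H' (Suc n) = H' n \<union> S ` H' n \<union> Y.P (- 1) ` H' n \<union> \<phi> ` (F' n \<inter> A)" for n
    by (simp_all add: F'_def H'_def w_def step_def case_prod_beta)
  have cA: "closedin (top_of_set X) A" "closedin (top_of_set Y) B"
    using clopen_A clopen_B by (auto simp: clopen_in_def)
  have nX: "null_fsigma M X (X.P i ` F)" if "null_fsigma M X F" for F i
    using null_fsigma_image[OF X.mp_homeo_carrier[OF carrier_X, of i] _ _ that] X.sets_M
      null_fsigma_subset[OF that] by (simp add: Int_absorb2)
  have nY: "null_fsigma N Y (Y.P i ` H)" if "null_fsigma N Y H" for H i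
    using null_fsigma_image[OF Y.mp_homeo_carrier[OF carrier_Y, of i] _ _ that] Y.sets_M
      null_fsigma_subset[OF that] by (simp add: Int_absorb2)
  have TS: "T ` F = X.P 1 ` F" "S ` H = Y.P 1 ` H" for F H by auto
  have nf: "null_fsigma M X (F' n) \<and> null_fsigma N Y (H' n)" for n
  proof (induction n)
    case (Suc n)
    have "null_fsigma M X (\<psi> ` (H' n \<inter> B))"
      using null_fsigma_image[OF mp_homeo_sym[OF mp_\<phi>] cA(2,1)] Suc X.sets_M Y.sets_M by simp
    moreover have "null_fsigma N Y (\<phi> ` (F' n \<inter> A))"
      using null_fsigma_image[OF mp_\<phi> cA] Suc X.sets_M Y.sets_M by simp
    ultimately show ?case
      unfolding wS using Suc nX[of "F' n" "- 1"] nY[of "H' n" "- 1"]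
        nX[of "F' n" 1, folded TS] nY[of "H' n" 1, folded TS]
      by (intro conjI null_fsigma_Un) blast+
  qed (use F H w0 in simp)
  define FF where "FF = (\<Union>n. F' n)"
  define HH where "HH = (\<Union>n. H' n)"
  have FF: "null_fsigma M X FF" "null_fsigma N Y HH"
    unfolding FF_def HH_def using nf by (auto intro!: null_fsigma_UN)
  have inv: "T ` FF \<subseteq> FF" "X.P (- 1) ` FF \<subseteq> FF" "S ` HH \<subseteq> HH" "Y.P (- 1) ` HH \<subseteq> HH"
    "\<psi> ` (HH \<inter> B) \<subseteq> FF" "\<phi> ` (FF \<inter> A) \<subseteq> HH"
  proof -
    have sub: "F' n \<subseteq> FF" "H' n \<subseteq> HH" for n unfolding FF_def HH_def by blast+
    have "T ` F' n \<subseteq> FF" "X.P (- 1) ` F' n \<subseteq> FF" "\<psi> ` (H' n \<inter> B) \<subseteq> FF"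
      "S ` H' n \<subseteq> HH" "Y.P (- 1) ` H' n \<subseteq> HH" "\<phi> ` (F' n \<inter> A) \<subseteq> HH" for n
      using sub[of "Suc n"] unfolding wS by simp_all
    then show "T ` FF \<subseteq> FF" "X.P (- 1) ` FF \<subseteq> FF" "S ` HH \<subseteq> HH" "Y.P (- 1) ` HH \<subseteq> HH"
      "\<psi> ` (HH \<inter> B) \<subseteq> FF" "\<phi> ` (FF \<inter> A) \<subseteq> HH"
      unfolding FF_def HH_def image_UN Int_UN_distrib2 by (auto simp: image_subset_iff Ball_def)
  qed
  show ?thesis
  proof (rule that)
    show "carrier_of M D T (X - FF)" "carrier_of N E S (Y - HH)"
      using X.carrier_diff_null_fsigma[OF carrier_X FF(1)]
        Y.carrier_diff_null_fsigma[OF carrier_Y FF(2)] inv by auto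
    show "X - FF \<subseteq> X - F" "Y - HH \<subseteq> Y - H" using w0 unfolding FF_def HH_def by blast+
    show "\<phi> ` (A \<inter> (X - FF)) = B \<inter> (Y - HH)"
    proof (intro equalityI subsetI)
      fix b assume "b \<in> \<phi> ` (A \<inter> (X - FF))"
      then obtain a where a: "a \<in> A" "a \<notin> FF" "b = \<phi> a" by blast
      then have b: "b \<in> B" "\<psi> b = a" using \<phi>_D(8,10) by simp_all
      then have "b \<notin> HH" using a inv(5) by (metis IntI image_subset_iff)
      then show "b \<in> B \<inter> (Y - HH)" using b B_sub by blast
    next
      fix b assume b: "b \<in> B \<inter> (Y - HH)"
      then have a: "\<psi> b \<in> A" "\<phi> (\<psi> b) = b" using \<phi>_D(9,11) by simp_all
      then have "\<psi> b \<notin> FF" using inv(6) b by (metis DiffD2 IntD2 IntI image_subset_iff)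
      then have "\<psi> b \<in> A \<inter> (X - FF)" using a A_sub by blast
      then show "b \<in> \<phi> ` (A \<inter> (X - FF))" using a(2) by (metis imageI)
    qed
  qed
qed

lemma induced_pair_restrict:
  assumes X': "carrier_of M D T X'" "X' \<subseteq> X" and Y': "carrier_of N E S Y'" "Y' \<subseteq> Y"
    and im: "\<phi> ` (A \<inter> X') = B \<inter> Y'"
  shows "induced_pair M D T N E S X' (A \<inter> X') Y' (B \<inter> Y') \<phi> \<psi>"
proof unfold_locales
  show "mp_homeo M (A \<inter> X') N (B \<inter> Y') \<phi> \<psi>"
    by (rule mp_homeo_subset[OF mp_\<phi> _ _ im]) (use \<phi>_D(2) X.carrier_borel[OF X'(1)] in auto)
  show "0 < emeasure M (A \<inter> X')"
    using X.emeasure_Int_nearly_full[of X' A] X'(1) pos_A \<phi>_D(2) X.sets_M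
    by (simp add: carrier_of_def)
qed (use assms clopen_in_subspace clopen_A clopen_B in auto)

end

section \<open>First return times\<close>

text \<open>
  The value is arbitrary at points that never return to \<open>A\<close>.
\<close>

definition first_return :: "('a \<Rightarrow> 'a) \<Rightarrow> 'a set \<Rightarrow> 'a \<Rightarrow> nat" where
  "first_return T A x = (LEAST r. 0 < r \<and> (T ^^ r) x \<in> A)"

lemma first_return:
  assumes "0 < n" "(T ^^ n) x \<in> A"
  shows "0 < first_return T A x" "(T ^^ first_return T A x) x \<in> A" "first_return T A x \<le> n"
    and "\<And>l. 0 < l \<Longrightarrow> l < first_return T A x \<Longrightarrow> (T ^^ l) x \<notin> A"
  using LeastI[of "\<lambda>r. 0 < r \<and> (T ^^ r) x \<in> A" n] Least_le[of "\<lambda>r. 0 < r \<and> (T ^^ r) x \<in> A" n]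
    not_less_Least[of _ "\<lambda>r. 0 < r \<and> (T ^^ r) x \<in> A"] assms
  unfolding first_return_def by auto

lemma return_time_eq_first_return:
  assumes "0 < n" "(T ^^ n) x \<in> A"
  shows "return_time T A x = enat (first_return T A x)"
  unfolding return_time_def
proof (rule cInf_eq_minimum)
  note r = first_return[of n T x A, OF assms]
  show "enat (first_return T A x) \<in> {enat r |r. 0 < r \<and> (T ^^ r) x \<in> A}" using r(1,2) by blast
  fix z assume "z \<in> {enat r |r. 0 < r \<and> (T ^^ r) x \<in> A}"
  then show "enat (first_return T A x) \<le> z" using first_return(3)[of _ T x A] by auto
qed

lemma first_return_Int:
  "(\<And>n. (T ^^ n) x \<in> X) \<Longrightarrow> first_return T (A \<inter> X) x = first_return T A x"
  by (simp add: first_return_def)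

text \<open>
  That the first return takes place at time \<open>r\<close> depends only on which of the iterates up to time \<open>r\<close>
  lie in \<open>A\<close>. These are finitely many locally constant conditions.
\<close>

lemma locally_constant_on_first_return:
  assumes lc: "\<And>n. locally_constant_on X (\<lambda>x. (T ^^ n) x \<in> A)"
    and ret: "\<And>x. x \<in> X \<Longrightarrow> \<exists>n>0. (T ^^ n) x \<in> A"
  shows "locally_constant_on X (first_return T A)"
  unfolding locally_constant_on_def
proof
  fix x assume x: "x \<in> X"
  define r where "r = first_return T A x"
  obtain n where n: "0 < n" "(T ^^ n) x \<in> A" using ret[OF x] by blast
  note r = first_return[of n T x A, OF n, folded r_def]
  have "\<forall>\<^sub>F y in at x within X. \<forall>l\<in>{..r}. ((T ^^ l) y \<in> A) = ((T ^^ l) x \<in> A)"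
    using lc x unfolding locally_constant_on_def by (simp add: eventually_ball_finite)
  then show "\<forall>\<^sub>F y in at x within X. first_return T A y = first_return T A x"
  proof eventually_elim
    case (elim y)
    have "(LEAST q. 0 < q \<and> (T ^^ q) y \<in> A) = r"
    proof (rule Least_equality)
      show "0 < r \<and> (T ^^ r) y \<in> A" using r elim by auto
      fix q assume q: "0 < q \<and> (T ^^ q) y \<in> A"
      show "r \<le> q"
      proof (rule ccontr)
        assume "\<not> r \<le> q"
        then show False using q elim r(4)[of q] by auto
      qed
    qed
    then show ?case by (simp add: first_return_def r_def)
  qed
qed

section \<open>How the conjugacy acts on orbits\<close>

text \<open>
  The situation once the points with only finitely many visits have been removed: the induced maps
  are defined on all of \<open>A\<close> and \<open>B\<close>, and \<open>\<phi>\<close> intertwines them without exceptions.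
\<close>

locale regular_pair = induced_pair +
  assumes visits_A: "\<And>x k. x \<in> X \<Longrightarrow> \<exists>n\<ge>k. (T ^^ n) x \<in> A"
    and visits_B: "\<And>y k. y \<in> Y \<Longrightarrow> \<exists>n\<ge>k. (S ^^ n) y \<in> B"
    and intertwine:
      "\<And>a. a \<in> A \<Longrightarrow> \<phi> ((T ^^ first_return T A a) a) = (S ^^ first_return S B (\<phi> a)) (\<phi> a)"
begin

lemma X_sub: "X \<subseteq> D" and Y_sub: "Y \<subseteq> E"
  using carrier_X carrier_Y by (auto simp: carrier_of_def)

lemma A_D: "a \<in> A \<Longrightarrow> a \<in> D" and B_E: "b \<in> B \<Longrightarrow> b \<in> E"
  using A_sub B_sub X_sub Y_sub by auto

lemma \<phi>_E: "a \<in> A \<Longrightarrow> \<phi> a \<in> E"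
  using \<phi>_D(8) B_E by blast

lemmas return_A = first_return[of _ T _ A]
lemmas return_B = first_return[of _ S _ B]

lemma returns_A: "a \<in> A \<Longrightarrow> \<exists>n>0. (T ^^ n) a \<in> A"
  using visits_A[of a 1] A_sub by (auto simp: Suc_le_eq)

lemma returns_B: "b \<in> B \<Longrightarrow> \<exists>n>0. (S ^^ n) b \<in> B"
  using visits_B[of b 1] B_sub by (auto simp: Suc_le_eq)

text \<open>
  A visit of a \<open>T\<close>-orbit to \<open>A\<close> is charged with the time that the corresponding point of \<open>B\<close> takes
  to return under \<open>S\<close>. The sums \<open>\<Theta>\<close> of these charges along an orbit convert \<open>T\<close>-time into
  \<open>S\<close>-time. Defined in this way they make sense on all of \<open>X\<close> and are visibly locally constant.
\<close>

definition \<theta> :: "'a \<Rightarrow> int" where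
  "\<theta> x = (if x \<in> A then int (first_return S B (\<phi> x)) else 0)"

definition \<Theta> :: "nat \<Rightarrow> 'a \<Rightarrow> int" where
  "\<Theta> n x = (\<Sum>l<n. \<theta> ((T ^^ l) x))"

lemma \<Theta>_add: "\<Theta> (m + n) x = \<Theta> m x + \<Theta> n ((T ^^ m) x)"
proof (induction n)
  case (Suc n)
  have "(T ^^ (m + n)) x = (T ^^ n) ((T ^^ m) x)" by (simp add: add.commute[of m] funpow_add)
  then show ?case using Suc by (simp add: \<Theta>_def)
qed (simp add: \<Theta>_def)

lemma \<Theta>_first_return:
  assumes a: "a \<in> A"
  shows "\<Theta> (first_return T A a) a = int (first_return S B (\<phi> a))"
proof -
  obtain n where n: "0 < n" "(T ^^ n) a \<in> A" using returns_A[OF a] by blast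
  have "(\<Sum>l\<in>{..<first_return T A a}. \<theta> ((T ^^ l) a)) = (\<Sum>l\<in>{0}. \<theta> ((T ^^ l) a))"
    using return_A[OF n] by (intro sum.mono_neutral_right) (auto simp: \<theta>_def)
  then show ?thesis using a by (simp add: \<Theta>_def \<theta>_def)
qed

text \<open>
  The \<open>T\<close>-orbit runs from \<open>a\<close> to its \<open>n\<close>-th iterate through successive visits to \<open>A\<close>, and the
  intertwining relation turns each step between visits into a step between visits to \<open>B\<close>. The
  induction splits off the first return.
\<close>

lemma cocycle_forward:
  "a \<in> A \<Longrightarrow> (T ^^ n) a \<in> A \<Longrightarrow> \<phi> ((T ^^ n) a) = Y.P (\<Theta> n a) (\<phi> a)"
proof (induction n arbitrary: a rule: less_induct)
  case (less n)
  show ?case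
  proof (cases "n = 0")
    case True
    then show ?thesis by (simp add: \<Theta>_def)
  next
    case False
    define r where "r = first_return T A a"
    define s where "s = first_return S B (\<phi> a)"
    define a' where "a' = (T ^^ r) a"
    have r: "0 < r" "a' \<in> A" "r \<le> n"
      using return_A[of n a] False less.prems by (auto simp: r_def a'_def)
    have n: "(T ^^ (n - r)) a' = (T ^^ n) a"
      unfolding a'_def using r(3) by (metis funpow_add le_add_diff_inverse2 o_apply)
    have "\<phi> ((T ^^ n) a) = Y.P (\<Theta> (n - r) a') (\<phi> a')"
      using less.IH[of "n - r" a'] less.prems r n by simp
    also have "\<phi> a' = Y.P (int s) (\<phi> a)"
      using intertwine[OF less.prems(1)] by (simp add: a'_def r_def s_def Y.P_nat)
    also have "Y.P (\<Theta> (n - r) a') (Y.P (int s) (\<phi> a)) = Y.P (\<Theta> (n - r) a' + int s) (\<phi> a)"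
      using Y.P_add[OF \<phi>_E] less.prems by simp
    also have "\<Theta> (n - r) a' + int s = \<Theta> n a"
      using \<Theta>_add[of r "n - r" a] \<Theta>_first_return[OF less.prems(1)] r(3)
      by (simp add: a'_def r_def s_def)
    finally show ?thesis .
  qed
qed

lemma cocycle:
  assumes x: "x \<in> X" and m: "(T ^^ m) x \<in> A" and n: "(T ^^ n) x \<in> A"
  shows "\<phi> ((T ^^ n) x) = Y.P (\<Theta> n x - \<Theta> m x) (\<phi> ((T ^^ m) x))"
proof -
  have *: "\<phi> ((T ^^ q) x) = Y.P (\<Theta> q x - \<Theta> p x) (\<phi> ((T ^^ p) x))"
    if "p \<le> q" "(T ^^ p) x \<in> A" "(T ^^ q) x \<in> A" for p q
  proof -
    have "(T ^^ (q - p)) ((T ^^ p) x) = (T ^^ q) x"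
      using that(1) by (metis funpow_add le_add_diff_inverse2 o_apply)
    moreover have "\<Theta> (q - p) ((T ^^ p) x) = \<Theta> q x - \<Theta> p x"
      using \<Theta>_add[of p "q - p" x] that(1) by simp
    ultimately show ?thesis using cocycle_forward[of "(T ^^ p) x" "q - p"] that by simp
  qed
  show ?thesis
  proof (cases "m \<le> n")
    case True
    then show ?thesis using * m n by blast
  next
    case False
    then have "\<phi> ((T ^^ m) x) = Y.P (\<Theta> m x - \<Theta> n x) (\<phi> ((T ^^ n) x))"
      using * m n by simp
    then show ?thesis
      using Y.P_add[OF \<phi>_E[OF n], of "\<Theta> n x - \<Theta> m x" "\<Theta> m x - \<Theta> n x"] by simp
  qed
qed

text \<open>
  Here the successive visits to \<open>B\<close> on the way from \<open>\<phi> a\<close> to \<open>\<phi> a'\<close> are pulled back to successive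
  visits to \<open>A\<close>, again by splitting off the first return.
\<close>

lemma orbit_reflect_forward:
  "a \<in> A \<Longrightarrow> a' \<in> A \<Longrightarrow> \<phi> a' = (S ^^ n) (\<phi> a) \<Longrightarrow> \<exists>i. a' = X.P i a"
proof (induction n arbitrary: a rule: less_induct)
  case (less n)
  show ?case
  proof (cases "n = 0")
    case True
    then have "a' = a" using less.prems \<phi>_D(10) by (metis funpow_0)
    then show ?thesis by (intro exI[of _ 0]) simp
  next
    case False
    define r where "r = first_return T A a"
    define s where "s = first_return S B (\<phi> a)"
    define a1 where "a1 = (T ^^ r) a"
    have "0 < n" "(S ^^ n) (\<phi> a) \<in> B"
      using False less.prems(3) \<phi>_D(8)[OF less.prems(2)] by simp_all
    then have s: "0 < s" "s \<le> n" unfolding s_def by (rule return_B)+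
    obtain q where "0 < q" "(T ^^ q) a \<in> A" using returns_A less.prems by blast
    then have a1: "a1 \<in> A" using return_A(2) by (simp add: a1_def r_def)
    have "\<phi> a1 = (S ^^ s) (\<phi> a)"
      using intertwine[OF less.prems(1)] by (simp add: a1_def r_def s_def)
    then have "\<phi> a' = (S ^^ (n - s)) (\<phi> a1)"
      using less.prems(3) s(2) by (metis funpow_add le_add_diff_inverse2 o_apply)
    then obtain i where "a' = X.P i a1"
      using less.IH[of "n - s" a1] s False a1 less.prems(2) by auto
    then have "a' = X.P (i + int r) a"
      using X.P_add[of a i "int r"] A_D less.prems(1) by (simp add: a1_def X.P_nat)
    then show ?thesis by blast
  qed
qed

lemma orbit_reflect:
  assumes a: "a \<in> A" "a' \<in> A" and k: "\<phi> a' = Y.P k (\<phi> a)"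
  shows "\<exists>i. a' = X.P i a"
proof (cases "0 \<le> k")
  case True
  then show ?thesis using orbit_reflect_forward[OF a, of "nat k"] k by (simp add: int_iter_def)
next
  case False
  have "\<phi> a = Y.P (- k) (\<phi> a')" using k Y.P_add[OF \<phi>_E[OF a(1)], of "- k" k] by simp
  then obtain i where "a = X.P i a'"
    using orbit_reflect_forward[OF a(2,1), of "nat (- k)"] False by (auto simp: int_iter_def)
  then have "a' = X.P (- i) a" using X.P_add[OF A_D[OF a(2)], of "- i" i] by simp
  then show ?thesis by blast
qed

lemma locally_constant_on_\<theta>: "locally_constant_on X \<theta>"
proof -
  have "locally_constant_on B (\<lambda>b. (S ^^ n) b \<in> B)" for n
  proof (rule locally_constant_on_subset[OF _ B_sub],
      rule locally_constant_on_compose[where f = "\<lambda>y. y \<in> B"])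
    show "locally_constant_on Y (\<lambda>y. y \<in> B)"
      using clopen_B by (simp add: clopen_in_iff_locally_constant_on)
  qed (use mp_homeoD[OF Y.mp_homeo_funpow_carrier[OF carrier_Y]] in auto)
  then have "locally_constant_on B (first_return S B)"
    using returns_B by (intro locally_constant_on_first_return)
  then have "locally_constant_on A (\<lambda>x. first_return S B (\<phi> x))"
    by (rule locally_constant_on_compose) (use \<phi>_D(4,6) in auto)
  then have "locally_constant_on A (\<lambda>x. int (first_return S B (\<phi> x)))"
    using locally_constant_on_map2[of A _ _ "\<lambda>a b. int a"] by blast
  then show ?thesis
    unfolding \<theta>_def[abs_def] by (rule locally_constant_on_if[OF clopen_A])
qed

lemma locally_constant_on_\<Theta>: "locally_constant_on X (\<Theta> n)"
  unfolding \<Theta>_def[abs_def]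
proof (rule locally_constant_on_sum)
  show "locally_constant_on X (\<lambda>x. \<theta> ((T ^^ k) x))" for k
    by (rule locally_constant_on_compose[OF locally_constant_on_\<theta>])
      (use mp_homeoD[OF X.mp_homeo_funpow_carrier[OF carrier_X]] in auto)
qed simp

section \<open>Matching the two carriers along corresponding orbits\<close>

text \<open>
  An enumeration of the pairs of exponents that starts with \<open>(0, 0)\<close>, so that the first map to be
  matched along is \<open>\<phi>\<close>.
\<close>

definition pre :: "nat \<Rightarrow> nat" where "pre n = fst (prod_decode n)"
definition post :: "nat \<Rightarrow> int" where "post n = int_decode (snd (prod_decode n))"

lemma pre_post_0: "pre 0 = 0" "post 0 = 0"
proof -
  have "prod_decode 0 = (0, 0)" by (simp add: prod_decode_def prod_decode_aux.simps)
  moreover have "int_decode 0 = 0" by (simp add: int_decode_def sum_decode_def)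
  ultimately show "pre 0 = 0" "post 0 = 0" by (simp_all add: pre_def post_def)
qed

lemma pre_post_surj: "\<exists>n. pre n = i \<and> post n = j"
  by (intro exI[of _ "prod_encode (i, int_encode j)"]) (simp add: pre_def post_def)

text \<open>
  As every forward orbit visits \<open>A\<close>, nonnegative exponents of \<open>T\<close> suffice to relate all pairs of
  points on corresponding orbits.
\<close>

definition match_map :: "nat \<Rightarrow> 'a \<Rightarrow> 'b" where
  "match_map n x = Y.P (post n) (\<phi> ((T ^^ pre n) x))"
definition match_inv :: "nat \<Rightarrow> 'b \<Rightarrow> 'a" where
  "match_inv n y = X.P (- int (pre n)) (\<psi> (Y.P (- post n) y))"
definition match_dom :: "nat \<Rightarrow> 'a set" where "match_dom n = {x\<in>X. (T ^^ pre n) x \<in> A}"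
definition match_ran :: "nat \<Rightarrow> 'b set" where "match_ran n = {y\<in>Y. Y.P (- post n) y \<in> B}"

lemma clopen_match_dom: "clopen_in X (match_dom n)"
  unfolding match_dom_def clopen_in_Collect_iff
proof (rule locally_constant_on_compose[where f = "\<lambda>x. x \<in> A"])
  show "locally_constant_on X (\<lambda>x. x \<in> A)"
    using clopen_A by (simp add: clopen_in_iff_locally_constant_on)
qed (use mp_homeoD[OF X.mp_homeo_funpow_carrier[OF carrier_X]] in auto)

lemma clopen_match_ran: "clopen_in Y (match_ran n)"
  unfolding match_ran_def clopen_in_Collect_iff
proof (rule locally_constant_on_compose[where f = "\<lambda>x. x \<in> B"])
  show "locally_constant_on Y (\<lambda>x. x \<in> B)"
    using clopen_B by (simp add: clopen_in_iff_locally_constant_on)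
qed (use mp_homeoD[OF Y.mp_homeo_carrier[OF carrier_Y]] in auto)

lemma mp_homeo_match_map: "mp_homeo M (match_dom n) N (match_ran n) (match_map n) (match_inv n)"
proof -
  note borel = X.carrier_borel[OF carrier_X] Y.carrier_borel[OF carrier_Y]
  note mT = X.mp_homeo_funpow_carrier[OF carrier_X, of "pre n"]
  note mS = Y.mp_homeo_carrier[OF carrier_Y, of "- post n"]
  have "(T ^^ pre n) ` match_dom n = A"
    using mp_homeoD(9,11)[OF mT] A_sub by (force simp: match_dom_def)
  then have 1: "mp_homeo M (match_dom n) M A (T ^^ pre n) (X.P (- int (pre n)))"
    by (intro mp_homeo_subset[OF mT] clopen_in_borel[OF clopen_match_dom] borel) (auto simp: match_dom_def)
  have "Y.P (- post n) ` match_ran n = B"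
    using mp_homeoD(9,11)[OF mS] B_sub by (force simp: match_ran_def)
  then have "mp_homeo N (match_ran n) N B (Y.P (- post n)) (Y.P (- (- post n)))"
    by (intro mp_homeo_subset[OF mS] clopen_in_borel[OF clopen_match_ran] borel) (auto simp: match_ran_def)
  then have 2: "mp_homeo N B N (match_ran n) (Y.P (post n)) (Y.P (- post n))"
    using mp_homeo_sym by fastforce
  show ?thesis
    using mp_homeo_trans[OF mp_homeo_trans[OF 1 mp_\<phi>] 2] by (simp add: match_map_def[abs_def] match_inv_def[abs_def])
qed

abbreviation piece :: "nat \<Rightarrow> 'a set" where "piece \<equiv> greedy_piece match_dom match_map"
abbreviation image_piece :: "nat \<Rightarrow> 'b set" where "image_piece n \<equiv> match_map n ` piece n"

definition h :: "'a \<Rightarrow> 'b" where "h = glue piece match_map"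
definition h_inv :: "'b \<Rightarrow> 'a" where "h_inv = glue image_piece match_inv"

lemmas clopen_piece =
  clopen_in_greedy_piece[of X match_dom Y match_ran match_map match_inv, OF clopen_match_dom clopen_match_ran mp_homeoD(1)[OF mp_homeo_match_map]]

lemma mp_homeo_h: "mp_homeo M (\<Union>n. piece n) N (\<Union>n. image_piece n) h h_inv"
  unfolding h_def h_inv_def
proof (rule mp_homeo_glue[where X = X and Y = Y])
  show "mp_homeo M (piece n) N (image_piece n) (match_map n) (match_inv n)" for n
    using clopen_in_borel[OF clopen_piece(1) X.carrier_borel[OF carrier_X]]
    by (intro mp_homeo_subset[OF mp_homeo_match_map] greedy_piece_subset) auto
qed (use clopen_piece in \<open>auto simp: clopen_in_def disjoint_family_greedy_piece
       disjoint_family_greedy_image X.sets_M Y.sets_M\<close>)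

lemma h_piece:
  assumes "x \<in> piece n"
  shows "h x = Y.P (post n) (\<phi> ((T ^^ pre n) x))" "(T ^^ pre n) x \<in> A" "x \<in> X"
proof -
  show "h x = Y.P (post n) (\<phi> ((T ^^ pre n) x))"
    using glue_eq[OF disjoint_family_greedy_piece assms, of match_map] unfolding h_def match_map_def[of n x] .
  have "x \<in> match_dom n" using greedy_piece_subset assms by (rule subsetD)
  then show "(T ^^ pre n) x \<in> A" "x \<in> X" by (simp_all add: match_dom_def)
qed

lemma piece_0: "piece 0 = A"
  using A_sub by (auto simp: greedy_piece_0 match_dom_def pre_post_0)

lemma h_A: "a \<in> A \<Longrightarrow> h a = \<phi> a"
  using h_piece(1)[of a 0] by (simp add: piece_0 pre_post_0)

definition unmatched_X where "unmatched_X = X - (\<Union>n. piece n)"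
definition unmatched_Y where "unmatched_Y = Y - (\<Union>n. image_piece n)"

lemma pieces_sub: "(\<Union>n. piece n) \<subseteq> X" "(\<Union>n. image_piece n) \<subseteq> Y"
  using clopen_piece unfolding clopen_in_iff_locally_constant_on by blast+

lemma closed_unmatched: "closedin (top_of_set X) unmatched_X" "closedin (top_of_set Y) unmatched_Y"
  unfolding unmatched_X_def unmatched_Y_def using clopen_piece
  by (auto simp: clopen_in_def intro!: closedin_diff openin_Union)

lemma borel_unmatched: "unmatched_X \<in> sets borel" "unmatched_Y \<in> sets borel"
  unfolding unmatched_X_def unmatched_Y_def
  using mp_homeoD(2,3)[OF mp_homeo_h] X.carrier_borel[OF carrier_X] Y.carrier_borel[OF carrier_Y]
  by auto

text \<open>
  From the unmatched point \<open>x\<close> on the orbit of \<open>a\<close> one continues to a visit to \<open>A\<close>, whose image under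
  \<open>\<phi>\<close> lies on the \<open>S\<close>-orbit of \<open>\<phi> a\<close>. So some map of the sequence sends \<open>x\<close> to the given unmatched
  point of \<open>Y\<close>, against the maximality of the matching.
\<close>

lemma unmatched_unrelated:
  assumes a: "a \<in> A" and x: "(T ^^ n) a \<in> unmatched_X" and y: "(S ^^ m) (\<phi> a) \<in> unmatched_Y"
  shows False
proof -
  define x where "x = (T ^^ n) a"
  have xX: "x \<in> X" "x \<notin> (\<Union>n. piece n)" using x by (auto simp: x_def unmatched_X_def)
  obtain i where i: "(T ^^ i) x \<in> A" using visits_A[OF xX(1)] by blast
  have Tx: "(T ^^ i) x = (T ^^ (i + n)) a" by (simp add: x_def funpow_add)
  then have "\<phi> ((T ^^ i) x) = Y.P (\<Theta> (i + n) a) (\<phi> a)"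
    using cocycle_forward[OF a, of "i + n"] i by simp
  then have "Y.P (int m - \<Theta> (i + n) a) (\<phi> ((T ^^ i) x)) = (S ^^ m) (\<phi> a)"
    using Y.P_add[OF \<phi>_E[OF a], of "int m - \<Theta> (i + n) a" "\<Theta> (i + n) a"] by (simp add: Y.P_nat)
  moreover obtain q where q: "pre q = i" "post q = int m - \<Theta> (i + n) a"
    using pre_post_surj by blast
  ultimately have "match_map q x = (S ^^ m) (\<phi> a)" by (simp add: match_map_def)
  moreover have "x \<in> match_dom q" using xX i q by (simp add: match_dom_def)
  ultimately have "(S ^^ m) (\<phi> a) \<in> (\<Union>n. image_piece n)"
    using greedy_piece_maximal[of x match_dom q match_map] xX by simp
  then show False using y by (simp add: unmatched_Y_def)
qed

lemma emeasure_unmatched: "emeasure M unmatched_X = emeasure N unmatched_Y"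
proof -
  have X: "emeasure M X = 1" "X \<in> sets M" and Y: "emeasure N Y = 1" "Y \<in> sets N"
    using carrier_X carrier_Y X.carrier_borel[OF carrier_X] Y.carrier_borel[OF carrier_Y]
    by (auto simp: carrier_of_def nearly_full_def X.sets_M Y.sets_M)
  have eq: "emeasure N (\<Union>n. image_piece n) = emeasure M (\<Union>n. piece n)"
    using mp_homeo_emeasure_image[OF mp_homeo_h] mp_homeoD(2,6)[OF mp_homeo_h] by fastforce
  have fin: "emeasure M (\<Union>n. piece n) \<noteq> \<infinity>" "emeasure N (\<Union>n. image_piece n) \<noteq> \<infinity>"
    using prob_space.finite_measure[OF X.prob] prob_space.finite_measure[OF Y.prob]
    by (simp_all add: finite_measure.emeasure_finite)
  have "emeasure M unmatched_X = 1 - emeasure M (\<Union>n. piece n)"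
    unfolding unmatched_X_def using X mp_homeoD(2)[OF mp_homeo_h] pieces_sub fin X.sets_M
    by (subst emeasure_Diff) auto
  moreover have "emeasure N unmatched_Y = 1 - emeasure N (\<Union>n. image_piece n)"
    unfolding unmatched_Y_def using Y mp_homeoD(3)[OF mp_homeo_h] pieces_sub fin Y.sets_M
    by (subst emeasure_Diff) auto
  ultimately show ?thesis using eq by simp
qed

text \<open>
  Otherwise both unmatched sets have positive measure. Then almost every point of \<open>A\<close> has an orbit
  through the first, almost every point of \<open>B\<close> has an orbit through the second, and since \<open>\<phi>\<close>
  preserves measure some point \<open>a\<close> of \<open>A\<close> has the first property while \<open>\<phi> a\<close> has the second.
\<close>

lemma unmatched_null: "emeasure M unmatched_X = 0"
proof (rule ccontr)
  assume "emeasure M unmatched_X \<noteq> 0"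
  then have pos: "0 < emeasure M unmatched_X" "0 < emeasure N unmatched_Y"
    using emeasure_unmatched by (auto simp: zero_less_iff_neq_zero)
  define Z where "Z = {x\<in>X. \<forall>k. \<exists>n\<ge>k. (T ^^ n) x \<in> unmatched_X}"
  define Z' where "Z' = {y\<in>Y. \<forall>k. \<exists>n\<ge>k. (S ^^ n) y \<in> unmatched_Y}"
  have Z: "Z \<in> sets borel" "emeasure M Z = 1"
    using X.frequent_visits_full[OF carrier_X borel_unmatched(1) _ pos(1), folded Z_def]
    by (simp_all add: unmatched_X_def)
  have Z': "Z' \<in> sets borel" "emeasure N Z' = 1"
    using Y.frequent_visits_full[OF carrier_Y borel_unmatched(2) _ pos(2), folded Z'_def]
    by (simp_all add: unmatched_Y_def)
  have null: "UNIV - Z \<in> null_sets M" "UNIV - Z' \<in> null_sets N"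
    using emeasure_compl[of Z M] emeasure_compl[of Z' N] Z Z' X.sets_M Y.sets_M
      prob_space.emeasure_space_1[OF X.prob] prob_space.emeasure_space_1[OF Y.prob]
    by (auto simp: X.space_M Y.space_M null_sets_def)
  have AZ: "A \<inter> Z \<in> sets borel" using Z \<phi>_D(2) by simp
  have "emeasure M (A \<inter> Z) = emeasure M A"
    using emeasure_Diff_null_set[OF null(1), of A] \<phi>_D(2) X.sets_M
    by (simp add: Diff_eq)
  then have "emeasure N (\<phi> ` (A \<inter> Z)) > 0"
    using mp_homeo_emeasure_image[OF mp_\<phi> AZ] pos_A by simp
  then have "\<not> \<phi> ` (A \<inter> Z) \<subseteq> UNIV - Z'"
    using null(2) by (metis emeasure_mono less_le_not_le null_setsD1 null_setsD2)
  then obtain a where "a \<in> A" "a \<in> Z" "\<phi> a \<in> Z'" by blast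
  then show False
    using unmatched_unrelated[of a] unfolding Z_def Z'_def by blast
qed

lemma null_fsigma_unmatched: "null_fsigma M X unmatched_X" "null_fsigma N Y unmatched_Y"
  using unmatched_null emeasure_unmatched borel_unmatched closed_unmatched X.sets_M Y.sets_M
  by (auto simp: null_fsigma_def null_sets_def closed_imp_fsigma_in)

section \<open>The matching is an orbit equivalence\<close>

definition piece_index :: "'a \<Rightarrow> nat" where "piece_index x = (THE n. x \<in> piece n)"

text \<open>
  If \<open>x\<close> is matched at stage \<open>n\<close>, then \<open>h x\<close> is reached from \<open>\<phi> (T\<^sup>i x)\<close>, with \<open>i = pre n\<close>, by
  \<open>post n\<close> steps of \<open>S\<close>. Adding the \<open>S\<close>-time \<open>\<Theta> i x\<close> that \<open>x\<close> is charged up to that visit to \<open>A\<close>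
  gives \<open>shift x\<close>, the transfer function that makes the cocycle of \<open>h T h_inv\<close> cohomologous to \<open>\<theta>\<close>.
\<close>

definition shift :: "'a \<Rightarrow> int" where "shift x = post (piece_index x) + \<Theta> (pre (piece_index x)) x"

definition conj_cocycle :: "'a \<Rightarrow> int" where "conj_cocycle x = shift (T x) - shift x + \<theta> x"

lemma piece_index_eq: "x \<in> piece n \<Longrightarrow> piece_index x = n"
  unfolding piece_index_def by (rule the_piece[OF disjoint_family_greedy_piece])

text \<open>
  Both \<open>h x\<close> and \<open>h (T x)\<close> are \<open>S\<close>-translates of images of visits of one orbit to \<open>A\<close>, and the
  \<open>S\<close>-time between these images is a difference of values of \<open>\<Theta>\<close>.
\<close>

lemma h_T:
  assumes "x \<in> (\<Union>n. piece n)" "T x \<in> (\<Union>n. piece n)"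
  shows "h (T x) = Y.P (conj_cocycle x) (h x)"
proof -
  obtain n m where n: "x \<in> piece n" and m: "T x \<in> piece m" using assms by blast
  note hx = h_piece[OF n] and hTx = h_piece[OF m]
  define b where "b = \<phi> ((T ^^ pre n) x)"
  have b: "b \<in> E" unfolding b_def using hx(2) by (rule \<phi>_E)
  have T1: "(T ^^ pre m) (T x) = (T ^^ (1 + pre m)) x" by (simp add: funpow_swap1)
  have "\<phi> ((T ^^ pre m) (T x)) = Y.P (\<Theta> (1 + pre m) x - \<Theta> (pre n) x) b"
    unfolding T1 b_def by (rule cocycle[OF hx(3,2)]) (use hTx(2) T1 in simp)
  also have "\<Theta> (1 + pre m) x = \<theta> x + \<Theta> (pre m) (T x)"
    using \<Theta>_add[of 1 "pre m" x] by (simp add: \<Theta>_def)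
  finally have "h (T x) = Y.P (post m + (\<theta> x + \<Theta> (pre m) (T x) - \<Theta> (pre n) x)) b"
    using hTx(1) Y.P_add[OF b] by simp
  also have "post m + (\<theta> x + \<Theta> (pre m) (T x) - \<Theta> (pre n) x) = conj_cocycle x + post n"
    using piece_index_eq[OF n] piece_index_eq[OF m] by (simp add: conj_cocycle_def shift_def)
  finally show ?thesis using hx(1) Y.P_add[OF b] by (simp add: b_def)
qed

lemma locally_constant_on_conj_cocycle:
  assumes "X2 \<subseteq> (\<Union>n. piece n)" "carrier_of M D T X2"
  shows "locally_constant_on X2 conj_cocycle"
proof -
  have sub: "X2 \<subseteq> X" using assms(1) pieces_sub by blast
  have piece_index: "locally_constant_on X2 piece_index"
    unfolding piece_index_def[abs_def]
    by (rule locally_constant_on_subset[OF locally_constant_on_the_piece assms(1)])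
      (use clopen_piece in \<open>auto simp: clopen_in_def disjoint_family_greedy_piece\<close>)
  have \<theta>: "locally_constant_on X2 \<theta>" and \<Theta>: "\<And>n. locally_constant_on X2 (\<Theta> n)"
    using locally_constant_on_\<theta> locally_constant_on_\<Theta> sub by (auto intro: locally_constant_on_subset)
  have shift: "locally_constant_on X2 shift"
    unfolding shift_def[abs_def]
    using locally_constant_on_map2[OF piece_index locally_constant_on_select[OF piece_index, of "\<lambda>n. \<Theta> (pre n)", OF \<Theta>],
        of "\<lambda>n t. post n + t"] by simp
  have "locally_constant_on X2 (\<lambda>x. shift (T x))"
    by (rule locally_constant_on_compose[OF shift])
      (use mp_homeoD(4,6)[OF X.mp_homeo_funpow_carrier[OF assms(2), of 1]] in auto)
  from locally_constant_on_map2[OF locally_constant_on_map2[OF this shift, of "(-)"] \<theta>, of "(+)"]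
  show ?thesis unfolding conj_cocycle_def[abs_def] .
qed

text \<open>
  The system \<open>T\<close> is conjugated by \<open>h\<close> to \<open>S' = h T h_inv\<close>, which inherits ergodicity. The orbits of
  \<open>S'\<close> are the images of \<open>T\<close>-orbits under \<open>h\<close>, so \<open>S'\<close> lies in the full group of \<open>S\<close> once these
  images are known to be whole \<open>S\<close>-orbits.
\<close>

lemma orbit_equivalence:
  "\<exists>X2 Y2. nc_orbit_equivalence M D T X2 N E S Y2 h \<and> X2 \<subseteq> X"
proof -
  obtain X2 Y2 where X2: "carrier_of M D T X2" and Y2: "carrier_of N E S Y2"
    and sub: "X2 \<subseteq> X - unmatched_X" "Y2 \<subseteq> Y - unmatched_Y" and im: "\<phi> ` (A \<inter> X2) = B \<inter> Y2"
    using saturate[OF null_fsigma_unmatched] by blast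
  have X2_pieces: "X2 \<subseteq> (\<Union>n. piece n)" and Y2_pieces: "Y2 \<subseteq> (\<Union>n. image_piece n)"
    using sub by (auto simp: unmatched_X_def unmatched_Y_def)
  have X2D: "\<And>x. x \<in> X2 \<Longrightarrow> x \<in> D" and Y2E: "\<And>y. y \<in> Y2 \<Longrightarrow> y \<in> E"
    using X2 Y2 by (auto simp: carrier_of_def)
  note PX = X.P_carrier[OF X2] and PY = Y.P_carrier[OF Y2]
  have \<phi>2: "\<phi> a \<in> Y2" if "a \<in> A" "a \<in> X2" for a using that im by blast
  have h_form: "\<exists>i j. X.P i x \<in> A \<and> X.P i x \<in> X2 \<and> h x = Y.P j (\<phi> (X.P i x))"
    if x: "x \<in> X2" for x
  proof -
    obtain n where n: "x \<in> piece n" using x X2_pieces by blast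
    show ?thesis
      using h_piece(1,2)[OF n] PX[OF x, of "int (pre n)"] X.P_nat by metis
  qed
  have h_in: "h x \<in> Y2" if x: "x \<in> X2" for x
  proof -
    obtain i j where "X.P i x \<in> A" "X.P i x \<in> X2" "h x = Y.P j (\<phi> (X.P i x))"
      using h_form[OF x] by blast
    then show ?thesis using PY[OF \<phi>2] by simp
  qed
  \<comment> \<open>Surjectivity uses that \<open>\<phi>\<close> maps the trace of \<open>A\<close> on \<open>X2\<close> onto that of \<open>B\<close> on \<open>Y2\<close>.\<close>
  have h_X2: "h ` X2 = Y2"
  proof (intro equalityI subsetI)
    fix y assume y: "y \<in> Y2"
    then obtain n x where n: "x \<in> piece n" and "y = match_map n x" using Y2_pieces by blast
    then have hx: "y = h x" using h_piece(1)[OF n] by (simp add: match_map_def)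
    note hp = h_piece[OF n]
    have "Y.P (- post n) y = \<phi> ((T ^^ pre n) x)"
      using hx hp(1) Y.P_add[OF \<phi>_E[OF hp(2)], of "- post n" "post n"] by simp
    then have "\<phi> ((T ^^ pre n) x) \<in> B \<inter> Y2"
      using PY[OF y, of "- post n"] \<phi>_D(8)[OF hp(2)] by simp
    then obtain a where a: "a \<in> A" "a \<in> X2" "\<phi> ((T ^^ pre n) x) = \<phi> a" using im by blast
    then have "(T ^^ pre n) x = a" using \<phi>_D(10) hp(2) by metis
    then have "X.P (- int (pre n)) ((T ^^ pre n) x) \<in> X2" using a PX by simp
    then have "x \<in> X2"
      using mp_homeoD(10)[OF X.mp_homeo_funpow_carrier[OF carrier_X] hp(3)] by simp
    then show "y \<in> h ` X2" using hx by blast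
  qed (use h_in in blast)
  have h2: "mp_homeo M X2 N Y2 h h_inv"
    by (rule mp_homeo_subset[OF mp_homeo_h X.carrier_borel[OF X2] X2_pieces h_X2])
  note h2D = mp_homeoD[OF h2]
  have T_in: "T x \<in> X2" if "x \<in> X2" for x using X.T_carrier[OF X2 that] .
  have hT: "h (T x) = Y.P (conj_cocycle x) (h x)" if "x \<in> X2" for x
    using h_T[of x] X2_pieces T_in[OF that] that by blast
  define S' where "S' y = h (T (h_inv y))" for y
  have S'h: "S' (h x) = h (T x)" if "x \<in> X2" for x
    using h2D(10)[OF that] by (simp add: S'_def)
  have mpT: "mp_homeo M X2 M X2 T (X.P (- 1))"
    using X.mp_homeo_funpow_carrier[OF X2, of 1] by simp
  have mpS': "mp_homeo N Y2 N Y2 S' (\<lambda>y. h (X.P (- 1) (h_inv y)))"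
    using mp_homeo_trans[OF mp_homeo_trans[OF mp_homeo_sym[OF h2] mpT] h2]
    by (simp add: S'_def[abs_def])
  note S'D = mp_homeoD[OF mpS']
  have full: "nearly_full N Y2" using Y2 by (simp add: carrier_of_def)
  have sysS': "nc_system N Y2 S'"
    unfolding nc_system_def
  proof (intro conjI ballI impI)
    show "polish_prob_space N" using Y.sys by (simp add: nc_system_def)
    show "nearly_full N Y2" by (rule full)
    show "homeo_betw Y2 Y2 S'" using S'D(1) by (auto simp: homeo_betw_def)
    show "measure_preserving (restrict_space N Y2) (restrict_space N Y2) S'"
      by (rule mp_homeo_imp_measure_preserving[OF mpS' Y.sets_M Y.sets_M])
    fix C assume C: "C \<in> sets N" "C \<subseteq> Y2 \<and> S' -` C \<inter> Y2 = C"
    have Cb: "C \<in> sets borel" "C \<subseteq> Y2" using C Y.sets_M by auto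
    \<comment> \<open>Ergodicity of \<open>T\<close> is applied to the preimage of \<open>C\<close> under \<open>h\<close>.\<close>
    have kC: "x \<in> h_inv ` C \<longleftrightarrow> x \<in> X2 \<and> h x \<in> C" for x
    proof
      assume "x \<in> h_inv ` C"
      then obtain y where "y \<in> C" "x = h_inv y" by blast
      then show "x \<in> X2 \<and> h x \<in> C" using h2D(9,11) Cb(2) by (metis subsetD)
    next
      assume "x \<in> X2 \<and> h x \<in> C"
      then show "x \<in> h_inv ` C" using h2D(10) by (metis imageI)
    qed
    have "T -` (h_inv ` C) \<inter> D = h_inv ` C"
    proof (intro equalityI subsetI)
      fix x assume "x \<in> T -` (h_inv ` C) \<inter> D"
      then have x: "x \<in> X2" "h (T x) \<in> C" using kC X.T_carrier_iff[OF X2] by auto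
      then have "h x \<in> S' -` C \<inter> Y2" using S'h h_in by simp
      then show "x \<in> h_inv ` C" using C x kC by blast
    next
      fix x assume "x \<in> h_inv ` C"
      then have x: "x \<in> X2" "h x \<in> C" using kC by auto
      then have "h x \<in> S' -` C \<inter> Y2" using C by blast
      then have "h (T x) \<in> C" using S'h x by simp
      then show "x \<in> T -` (h_inv ` C) \<inter> D" using kC T_in X2D x by simp
    qed
    moreover have "h_inv ` C \<in> sets M" "h_inv ` C \<subseteq> D"
      using mp_homeo_image_borel[OF mp_homeo_sym[OF h2] Cb] X.sets_M kC X2D by auto
    moreover have "emeasure M (h_inv ` C) = emeasure N C"
      using mp_homeo_emeasure_image[OF mp_homeo_sym[OF h2] Cb] .
    ultimately show "emeasure N C = 0 \<or> emeasure N C = 1" using X.ergodic by metis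
  qed
  interpret Y': nc_dynamics N Y2 S' by unfold_locales (rule sysS')
  have iter: "Y'.P i (h x) = h (X.P i x)" if x: "x \<in> X2" for i x
  proof (induction i rule: int_induct[where k = 0])
    case (step1 i)
    then show ?case
      using Y'.P_Suc[OF h_in[OF x], of i] X.P_Suc[OF X2D[OF x], of i] S'h[OF PX[OF x]] by simp
  next
    case (step2 i)
    have "S' (Y'.P (i - 1) (h x)) = S' (h (X.P (i - 1) x))"
      using step2 Y'.P_Suc[OF h_in[OF x], of "i - 1"] X.P_Suc[OF X2D[OF x], of "i - 1"]
        S'h[OF PX[OF x], of "i - 1"] by simp
    then show ?case
      using S'D(10) Y'.P_in_D[OF h_in[OF x]] h_in[OF PX[OF x]] by metis
  qed simp
  have orb_image: "orb Y2 S' (h x) = h ` orb D T x" if "x \<in> X2" for x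
    using iter[OF that] by (auto simp: orb_def)
  \<comment> \<open>One inclusion between orbits: a step of \<open>T\<close> does not leave the \<open>S\<close>-orbit of the image.\<close>
  have orb_const: "orb E S (h (X.P i x)) = orb E S (h x)" if x: "x \<in> X2" for i x
  proof (induction i rule: int_induct[where k = 0])
    case (step1 i)
    then show ?case
      using hT[OF PX[OF x], of i] X.P_Suc[OF X2D[OF x], of i] Y.orb_P[OF Y2E[OF h_in[OF PX[OF x]]]] by simp
  next
    case (step2 i)
    then show ?case
      using hT[OF PX[OF x], of "i - 1"] X.P_Suc[OF X2D[OF x], of "i - 1"]
        Y.orb_P[OF Y2E[OF h_in[OF PX[OF x]]], of _ "i - 1"] by simp
  qed simp
  have self: "y \<in> orb E S y" for y
    unfolding orb_def by (rule range_eqI[where x = 0]) simp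
  have orb_h: "h ` orb D T x = orb E S (h x)" if x: "x \<in> X2" for x
  proof (intro equalityI subsetI)
    fix y assume "y \<in> h ` orb D T x"
    then obtain i where "y = h (X.P i x)" by (auto simp: orb_def)
    then show "y \<in> orb E S (h x)" using self[of y] orb_const[OF x, of i] by simp
  next
    fix y assume "y \<in> orb E S (h x)"
    then obtain q where q: "y = Y.P q (h x)" by (auto simp: orb_def)
    then have "y \<in> Y2" using PY h_in[OF x] by simp
    then obtain x' where x': "x' \<in> X2" "y = h x'" using h_X2 by blast
    \<comment> \<open>Two points of \<open>X2\<close> whose images share an \<open>S\<close>-orbit pass through visits to \<open>A\<close> with the same property.\<close>
    obtain i j where a: "X.P i x \<in> A" "X.P i x \<in> X2" "h x = Y.P j (\<phi> (X.P i x))"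
      using h_form[OF x] by blast
    obtain i' j' where a': "X.P i' x' \<in> A" "X.P i' x' \<in> X2" "h x' = Y.P j' (\<phi> (X.P i' x'))"
      using h_form[OF x'(1)] by blast
    have "\<phi> (X.P i' x') = Y.P (- j') y"
      using a'(3) x'(2) Y.P_add[OF \<phi>_E[OF a'(1)], of "- j'" j'] by simp
    also have "\<dots> = Y.P (- j' + (q + j)) (\<phi> (X.P i x))"
      unfolding q a(3) Y.P_add[OF \<phi>_E[OF a(1)]] ..
    finally obtain l where "X.P i' x' = X.P l (X.P i x)"
      using orbit_reflect[OF a(1) a'(1)] by blast
    then have "x' = X.P (- i' + (l + i)) x"
      using X.P_add[OF X2D[OF x'(1)], of "- i'" i'] unfolding X.P_add[OF X2D[OF x]] by simp
    then show "y \<in> h ` orb D T x" using x'(2) by (auto simp: orb_def)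
  qed
  have carS': "carrier_of N Y2 S' Y2" using full S'D(6) by (simp add: carrier_of_def)
  have "(D, T) \<in> full_group M D T"
  proof -
    have "carrier_of M D T D" using X.nearly_full_D X.T_D(6) by (simp add: carrier_of_def)
    moreover have "nearly_continuous M (\<lambda>x. 1 :: int)"
      unfolding nearly_continuous_def using X.nearly_full_D by (auto intro: continuous_on_const)
    moreover have "\<forall>x\<in>D. T x = X.P 1 x" by simp
    ultimately show ?thesis
      unfolding full_group_def using X.sys by blast
  qed
  moreover have "(Y2, S') \<in> full_group N E S"
  proof -
    have "\<forall>y\<in>Y2. orb Y2 S' y = orb E S y"
    proof
      fix y assume "y \<in> Y2"
      then obtain x where "x \<in> X2" "y = h x" using h_X2 by blast
      then show "orb Y2 S' y = orb E S y" using orb_image orb_h by simp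
    qed
    moreover have "nearly_continuous N (\<lambda>y. conj_cocycle (h_inv y))"
    proof -
      have "locally_constant_on Y2 (\<lambda>y. conj_cocycle (h_inv y))"
        by (rule locally_constant_on_compose[OF locally_constant_on_conj_cocycle[OF X2_pieces X2]])
          (use h2D in auto)
      then show ?thesis
        unfolding nearly_continuous_def using full locally_constant_on_imp_continuous_on by blast
    qed
    moreover have "\<forall>y\<in>Y2. S' y = Y.P (conj_cocycle (h_inv y)) y"
      using hT h2D(9,11) by (simp add: S'_def)
    ultimately show ?thesis
      unfolding full_group_def using sysS' Y2 carS' by blast
  qed
  moreover have "nc_conjugacy M D T X2 N Y2 S' Y2 h"
    unfolding nc_conjugacy_def
    using X2 carS' h2D(1) mp_homeo_imp_measure_preserving[OF h2 X.sets_M Y.sets_M] S'h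
    by (auto simp: homeo_betw_def)
  ultimately have "nc_orbit_equivalence M D T X2 N E S Y2 h"
    unfolding nc_orbit_equivalence_def using X2 Y2 orb_h by blast
  then show ?thesis using sub(1) by blast
qed

end

section \<open>Extending the conjugacy of the induced maps\<close>

theorem theorem1p1:
  fixes M :: "'a::polish_space measure" and D :: "'a set" and T :: "'a \<Rightarrow> 'a"
    and N :: "'b::polish_space measure" and E :: "'b set" and S :: "'b \<Rightarrow> 'b"
    and A X0 :: "'a set" and B Y0 :: "'b set" and \<phi> :: "'a \<Rightarrow> 'b"
  assumes "nc_system M D T" and "nc_system N E S"
    and "nearly_clopen M A" and "nearly_clopen N B"
    and "emeasure (completion M) A = emeasure (completion N) B"
    and "emeasure (completion M) A > 0"
    and "nc_induced_conjugacy M D T A X0 N E S B Y0 \<phi>"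
  shows "\<exists>Xs Ys \<phi>'.
           carrier_of M D T Xs \<and> carrier_of N E S Ys \<and>
           nc_orbit_equivalence M D T Xs N E S Ys \<phi>' \<and>
           (\<forall>x\<in>(A \<inter> X0) \<inter> Xs. \<phi>' x = \<phi> x)"
proof -
  interpret X: nc_dynamics M D T by unfold_locales (rule assms(1))
  interpret Y: nc_dynamics N E S by unfold_locales (rule assms(2))
  define A0 where "A0 = A \<inter> X0"
  define B0 where "B0 = B \<inter> Y0"
  note conj = assms(7)[unfolded nc_induced_conjugacy_def, folded A0_def B0_def]
  have X0: "carrier_of M D T X0" and Y0: "carrier_of N E S Y0"
    and cl: "clopen_in X0 A0" "clopen_in Y0 B0" using conj by auto
  obtain \<psi> where \<psi>: "homeomorphism A0 B0 \<phi> \<psi>" using conj by (auto simp: homeo_betw_def)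
  have borel: "A0 \<in> sets borel" "B0 \<in> sets borel"
    using clopen_in_borel[OF cl(1) X.carrier_borel[OF X0]]
      clopen_in_borel[OF cl(2) Y.carrier_borel[OF Y0]] by auto
  have A0: "emeasure (completion M) A = emeasure M A0"
    unfolding A0_def using X0 borel X.sets_M
    by (intro X.emeasure_completion_nearly_full) (auto simp: carrier_of_def A0_def)
  have B0: "emeasure (completion N) B = emeasure N B0"
    unfolding B0_def using Y0 borel Y.sets_M
    by (intro Y.emeasure_completion_nearly_full) (auto simp: carrier_of_def B0_def)
  have "mp_homeo M A0 N B0 \<phi> \<psi>"
    using \<psi> borel X.sets_M X.prob Y.sets_M assms(5,6) conj unfolding A0 B0
    by (intro mp_homeo_of_normalized) auto
  then interpret P0: induced_pair M D T N E S X0 A0 Y0 B0 \<phi> \<psi>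
    using X0 Y0 cl assms(6) A0 by unfold_locales auto
  \<comment> \<open>The induced maps may be undefined somewhere on the orbits of these points.\<close>
  define F where "F = {x\<in>X0. \<not> (\<forall>k. \<exists>n\<ge>k. (T ^^ n) x \<in> A0)}"
  define H where "H = {y\<in>Y0. \<not> (\<forall>k. \<exists>n\<ge>k. (S ^^ n) y \<in> B0)}"
  have F: "null_fsigma M X0 F" and H: "null_fsigma N Y0 H"
    unfolding F_def H_def
    using X.infrequent_visits_null_fsigma[OF X0 borel(1) P0.pos_A] 
      Y.infrequent_visits_null_fsigma[OF Y0 borel(2) P0.pos_B] cl
    by (simp_all add: clopen_in_def)
  obtain X1 Y1 where X1: "carrier_of M D T X1" and Y1: "carrier_of N E S Y1"
    and sub: "X1 \<subseteq> X0 - F" "Y1 \<subseteq> Y0 - H" and im: "\<phi> ` (A0 \<inter> X1) = B0 \<inter> Y1"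
    using P0.saturate[OF F H] by blast
  have sub': "X1 \<subseteq> X0" "Y1 \<subseteq> Y0" using sub by auto
  interpret P1: induced_pair M D T N E S X1 "A0 \<inter> X1" Y1 "B0 \<inter> Y1" \<phi> \<psi>
    by (rule P0.induced_pair_restrict[OF X1 sub'(1) Y1 sub'(2) im])
  have visX: "\<exists>n\<ge>k. (T ^^ n) x \<in> A0" if "x \<in> X1" for x k
    using that sub(1) unfolding F_def by blast
  have visY: "\<exists>n\<ge>k. (S ^^ n) y \<in> B0" if "y \<in> Y1" for y k
    using that sub(2) unfolding H_def by blast
  interpret P2: regular_pair M D T N E S X1 "A0 \<inter> X1" Y1 "B0 \<inter> Y1" \<phi> \<psi>
  proof unfold_locales
    show "\<exists>n\<ge>k. (T ^^ n) x \<in> A0 \<inter> X1" if "x \<in> X1" for x k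
      using visX[OF that, of k] X.funpow_carrier[OF X1 that] by blast
    show "\<exists>n\<ge>k. (S ^^ n) y \<in> B0 \<inter> Y1" if "y \<in> Y1" for y k
      using visY[OF that, of k] Y.funpow_carrier[OF Y1 that] by blast
    fix a assume a: "a \<in> A0 \<inter> X1"
    then have b: "\<phi> a \<in> B0" "\<phi> a \<in> Y1" using im by auto
    obtain n where n: "1 \<le> n" "(T ^^ n) a \<in> A0" using visX[of a 1] a by blast
    obtain m where m: "1 \<le> m" "(S ^^ m) (\<phi> a) \<in> B0" using visY[OF b(2), of 1] by blast
    have rA: "return_time T A0 a = enat (first_return T A0 a)"
      by (rule return_time_eq_first_return[of n]) (use n in auto)
    have rB: "return_time S B0 (\<phi> a) = enat (first_return S B0 (\<phi> a))"
      by (rule return_time_eq_first_return[of m]) (use m in auto)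
    have "\<phi> (induced_map T A0 a) = induced_map S B0 (\<phi> a)"
      using conj a rA rB by auto
    then show "\<phi> ((T ^^ first_return T (A0 \<inter> X1) a) a) =
        (S ^^ first_return S (B0 \<inter> Y1) (\<phi> a)) (\<phi> a)"
      using rA rB first_return_Int[of T a X1 A0] first_return_Int[of S "\<phi> a" Y1 B0]
        X.funpow_carrier[OF X1] Y.funpow_carrier[OF Y1 b(2)] a
      by (simp add: induced_map_def)
  qed
  obtain X2 Y2 where oe: "nc_orbit_equivalence M D T X2 N E S Y2 P2.h" and "X2 \<subseteq> X1"
    using P2.orbit_equivalence by blast
  have "\<forall>x\<in>(A \<inter> X0) \<inter> X2. P2.h x = \<phi> x"
    using P2.h_A \<open>X2 \<subseteq> X1\<close> by (auto simp: A0_def)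
  moreover have "carrier_of M D T X2" "carrier_of N E S Y2"
    using oe by (auto simp: nc_orbit_equivalence_def)
  ultimately show ?thesis using oe by blast
qed

end
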